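(* Let $\alpha\in\mathbb{C}$ and $\Delta,\bar\Delta\in\mathbb{C}^*$. Consider extensions of conformal $\widetilde{\mathrm{SV}}$-modules $$0\to V(\alpha,0,\bar\Delta)\to E\to V(\alpha,0,\Delta)\to0,$$ realized as $E=\mathbb{C}[\partial]v_{\bar\Delta}\oplus\mathbb{C}[\partial]v_\Delta$ with $\mathbb{C}[\partial]v_{\bar\Delta}\cong V(\alpha,0,\bar\Delta)$ a submodule and $$L_\lambda v_\Delta=(\partial+\alpha+\Delta\lambda)v_\Delta+f(\partial,\lambda)v_{\bar\Delta},\ M_\lambda v_\Delta=g(\partial,\lambda)v_{\bar\Delta},\ N_\lambda v_\Delta=k(\partial,\lambda)v_{\bar\Delta},\ Y_\lambda v_\Delta=h(\partial,\lambda)v_{\bar\Delta},$$ with $f,g,h,k\in\mathbb{C}[\partial,\lambda]$. Nontrivial extensions of this form exist only if $\Delta-\bar\Delta\in\{0,1,2,3,4,5,6\}$. In these cases they are given, up to equivalence, as follows (with $\bar\partial=\partial+\alpha$), and always $g=h=0$: (i) $\Delta=\bar\Delta$: $f=c_0+c_1\lambda$, $k=a_0$, $(c_0,c_1,a_0)\neq(0,0,0)$; (ii) $\Delta-\bar\Delta=1$: $f=0$, $k=a_1\lambda$, $a_1\neq0$; (iii) $\Delta-\bar\Delta=2$: $f=c_2\lambda^2(2\bar\partial+\lambda)$, $k=a_2\lambda(\bar\partial-\bar\Delta\lambda)$, $(c_2,a_2)\neq(0,0)$; (iv) $(\Delta,\bar\Delta)=(1,-2)$: $f=c_3\bar\partial\lambda^2(\bar\partial+\lambda)$,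 $k=a_3\lambda(\bar\partial^2+3\bar\partial\lambda+2\lambda^2)$, $(c_3,a_3)\neq(0,0)$; (iv') $\Delta-\bar\Delta=3$, $\bar\Delta\neq-2$: $k=0$, $f=c_3\bar\partial\lambda^2(\bar\partial+\lambda)$, $c_3\neq0$; (v) $\Delta-\bar\Delta=4$: $k=0$, $f=c_5\lambda^2(4\bar\partial^3+6\bar\partial^2\lambda-\bar\partial\lambda^2+\bar\Delta\lambda^3)$, $c_5\neq0$; (vi) $(\Delta,\bar\Delta)=(1,-4)$: $k=0$, $f=c_6(\bar\partial^4\lambda^2-10\bar\partial^2\lambda^4-17\bar\partial\lambda^5-8\lambda^6)$, $c_6\neq0$; (vii) $(\Delta,\bar\Delta)=(\tfrac72\pm\tfrac{\sqrt{19}}2,-\tfrac52\pm\tfrac{\sqrt{19}}2)$: $k=0$, $f=c_7\big(\bar\partial^4\lambda^3-(2\bar\Delta+3)\bar\partial^3\lambda^4-3\bar\Delta\bar\partial^2\lambda^5-(3\bar\Delta+1)\bar\partial\lambda^6-(\bar\Delta+\tfrac9{28})\lambda^7\big)$, $c_7\neq0$.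
   Context: A conformal module over a Lie conformal algebra $R$ is a $\mathbb{C}[\partial]$-module $V$ with $a\mapsto a_\lambda\in\mathrm{End}_{\mathbb{C}}(V)\otimes\mathbb{C}[\lambda]$ satisfying $[a_\lambda,b_\mu]=[a_\lambda b]_{\lambda+\mu}$ and $(\partial a)_\lambda=[\partial,a_\lambda]=-\lambda a_\lambda$. $\widetilde{\mathrm{SV}}$ is the Lie conformal algebra that is the free $\mathbb{C}[\partial]$-module with basis $L,M,Y,N$ whose nonzero $\lambda$-brackets (up to skew-symmetry) are $[L_\lambda L]=(\partial+2\lambda)L$, $[L_\lambda Y]=(\partial+\tfrac32\lambda)Y$, $[L_\lambda M]=(\partial+\lambda)M$, $[Y_\lambda Y]=(\partial+2\lambda)M$, $[L_\lambda N]=(\partial+\lambda)N$, $[N_\lambda M]=2M$, $[N_\lambda Y]=Y$. $V(\alpha,\beta,\Delta)=\mathbb{C}[\partial]v_\Delta$ with $L_\lambda v_\Delta=(\partial+\alpha+\Delta\lambda)v_\Delta$, $N_\lambda v_\Delta=\beta v_\Delta$, $M_\lambda v_\Delta=Y_\lambda v_\Delta=0$. An extension of $W$ by $V$ is an exact sequence $0\to V\to E\to W\to0$ of conformal modules; equivalence via a module map of middle terms compatible with identities; trivial means equivalent to the direct sum. *)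

theory Defs
  imports Complex_Main "HOL-Computational_Algebra.Polynomial"
begin

datatype gen = L | M | Y | N

text \<open>Coefficient of generator c in the given lambda-brackets [a_lambda b],
  as a function of the values of (partial, lambda).\<close>
fun given_br :: "gen \<Rightarrow> gen \<Rightarrow> gen \<Rightarrow> complex \<Rightarrow> complex \<Rightarrow> complex" where
  "given_br L L L d l = d + 2 * l"
| "given_br L Y Y d l = d + 3/2 * l"
| "given_br L M M d l = d + l"
| "given_br Y Y M d l = d + 2 * l"
| "given_br L N N d l = d + l"
| "given_br N M M d l = 2"
| "given_br N Y Y d l = 1"
| "given_br _ _ _ d l = 0"

definition is_given :: "gen \<Rightarrow> gen \<Rightarrow> bool" where
  "is_given a b \<longleftrightarrow> (a, b) \<in> {(L,L),(L,Y),(L,M),(Y,Y),(L,N),(N,M),(N,Y)}"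

text \<open>All brackets, completed by skew-symmetry [b_lambda a] = - [a_{-lambda-partial} b];
  all remaining brackets are zero.\<close>
definition sv_br :: "gen \<Rightarrow> gen \<Rightarrow> gen \<Rightarrow> complex \<Rightarrow> complex \<Rightarrow> complex" where
  "sv_br a b c d l =
     (if is_given a b then given_br a b c d l
      else if is_given b a then - given_br b a c d (- l - d)
      else 0)"

text \<open>A polynomial in partial and lambda is a polynomial in lambda whose
  coefficients are polynomials in partial.\<close>
type_synonym bipoly = "complex poly poly"

definition Lam :: bipoly where "Lam = [:0, 1:]"
definition Dpa :: bipoly where "Dpa = [:[:0, 1:]:]"
definition cst :: "complex \<Rightarrow> bipoly" where "cst c = [:[:c:]:]"

definition ev :: "bipoly \<Rightarrow> complex \<Rightarrow> complex poly" where
  "ev f l = poly f [:l:]"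

definition shift :: "complex poly \<Rightarrow> complex \<Rightarrow> complex poly" where
  "shift p l = pcompose p [:l, 1:]"

text \<open>An element (p, q) stands for p(partial) v_Dbar + q(partial) v_D.\<close>
type_synonym elt = "complex poly \<times> complex poly"

definition eadd :: "elt \<Rightarrow> elt \<Rightarrow> elt" where
  "eadd x y = (fst x + fst y, snd x + snd y)"
definition esub :: "elt \<Rightarrow> elt \<Rightarrow> elt" where
  "esub x y = (fst x - fst y, snd x - snd y)"
definition esc :: "complex poly \<Rightarrow> elt \<Rightarrow> elt" where
  "esc s x = (s * fst x, s * snd x)"

text \<open>Action on the generator of V(alpha, 0, Delta): L acts by partial+alpha+Delta lambda,
  N by beta = 0, M and Y by 0.\<close>
definition base :: "complex \<Rightarrow> complex \<Rightarrow> gen \<Rightarrow> complex \<Rightarrow> complex poly" where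
  "base al Dl a l = (if a = L then [:al + Dl * l, 1:] else 0)"

definition Fof :: "bipoly \<Rightarrow> bipoly \<Rightarrow> bipoly \<Rightarrow> bipoly \<Rightarrow> gen \<Rightarrow> bipoly" where
  "Fof f g h k a = (case a of L \<Rightarrow> f | M \<Rightarrow> g | N \<Rightarrow> k | Y \<Rightarrow> h)"

text \<open>a_l acting on p(partial) v_Dbar + q(partial) v_D, extended by sesquilinearity
  a_l (p(partial) v) = p(partial + l) a_l v.\<close>
definition act :: "complex \<Rightarrow> complex \<Rightarrow> complex \<Rightarrow> bipoly \<Rightarrow> bipoly \<Rightarrow> bipoly \<Rightarrow> bipoly
    \<Rightarrow> gen \<Rightarrow> complex \<Rightarrow> elt \<Rightarrow> elt" where
  "act al Dbar Dl f g h k a l x =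
     (shift (fst x) l * base al Dbar a l + shift (snd x) l * ev (Fof f g h k a) l,
      shift (snd x) l * base al Dl a l)"

text \<open>Conformal module axioms (lambda ranges over complex values; both sides are
  polynomial in lambda, mu, so this is equivalent to the polynomial identity).\<close>
definition is_conf_mod :: "(gen \<Rightarrow> complex \<Rightarrow> elt \<Rightarrow> elt) \<Rightarrow> bool" where
  "is_conf_mod A \<longleftrightarrow>
     (\<forall>a l x y. A a l (eadd x y) = eadd (A a l x) (A a l y)) \<and>
     (\<forall>a l c x. A a l (esc [:c:] x) = esc [:c:] (A a l x)) \<and>
     (\<forall>a l x. A a l (esc [:0, 1:] x) = esc [:l, 1:] (A a l x)) \<and>
     (\<forall>a b l m x. esub (A a l (A b m x)) (A b m (A a l x)) =
        foldr eadd (map (\<lambda>c. esc [:sv_br a b c (- (l + m)) l:] (A c (l + m) x)) [L, M, Y, N])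
          (0, 0))"

definition is_ext :: "complex \<Rightarrow> complex \<Rightarrow> complex \<Rightarrow> bipoly \<Rightarrow> bipoly \<Rightarrow> bipoly \<Rightarrow> bipoly \<Rightarrow> bool" where
  "is_ext al Dbar Dl f g h k = is_conf_mod (act al Dbar Dl f g h k)"

definition ext_equiv :: "complex \<Rightarrow> complex \<Rightarrow> complex
    \<Rightarrow> bipoly \<times> bipoly \<times> bipoly \<times> bipoly \<Rightarrow> bipoly \<times> bipoly \<times> bipoly \<times> bipoly \<Rightarrow> bool" where
  "ext_equiv al Dbar Dl E E' =
     (case E of (f, g, h, k) \<Rightarrow> case E' of (f', g', h', k') \<Rightarrow>
       (\<exists>\<phi> :: elt \<Rightarrow> elt.
          (\<forall>x y. \<phi> (eadd x y) = eadd (\<phi> x) (\<phi> y)) \<and>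
          (\<forall>s x. \<phi> (esc s x) = esc s (\<phi> x)) \<and>
          (\<forall>p. \<phi> (p, 0) = (p, 0)) \<and>
          (\<forall>x. snd (\<phi> x) = snd x) \<and>
          (\<forall>a l x. \<phi> (act al Dbar Dl f g h k a l x) = act al Dbar Dl f' g' h' k' a l (\<phi> x))))"

definition ext_trivial :: "complex \<Rightarrow> complex \<Rightarrow> complex \<Rightarrow> bipoly \<Rightarrow> bipoly \<Rightarrow> bipoly \<Rightarrow> bipoly \<Rightarrow> bool" where
  "ext_trivial al Dbar Dl f g h k = ext_equiv al Dbar Dl (f, g, h, k) (0, 0, 0, 0)"

definition listed :: "complex \<Rightarrow> complex \<Rightarrow> complex \<Rightarrow> bipoly \<Rightarrow> bipoly \<Rightarrow> bool" where
  "listed al Dbar Dl f k =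
    (let Db = Dpa + cst al in
     (Dl = Dbar \<and> (\<exists>c0 c1 a0. (c0, c1, a0) \<noteq> (0, 0, 0) \<and>
        f = cst c0 + cst c1 * Lam \<and> k = cst a0))
   \<or> (Dl - Dbar = 1 \<and> (\<exists>a1. a1 \<noteq> 0 \<and> f = 0 \<and> k = cst a1 * Lam))
   \<or> (Dl - Dbar = 2 \<and> (\<exists>c2 a2. (c2, a2) \<noteq> (0, 0) \<and>
        f = cst c2 * Lam^2 * (2 * Db + Lam) \<and> k = cst a2 * Lam * (Db - cst Dbar * Lam)))
   \<or> (Dl = 1 \<and> Dbar = -2 \<and> (\<exists>c3 a3. (c3, a3) \<noteq> (0, 0) \<and>
        f = cst c3 * Db * Lam^2 * (Db + Lam) \<and>
        k = cst a3 * Lam * (Db^2 + 3 * Db * Lam + 2 * Lam^2)))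
   \<or> (Dl - Dbar = 3 \<and> Dbar \<noteq> -2 \<and> (\<exists>c3. c3 \<noteq> 0 \<and> k = 0 \<and>
        f = cst c3 * Db * Lam^2 * (Db + Lam)))
   \<or> (Dl - Dbar = 4 \<and> (\<exists>c5. c5 \<noteq> 0 \<and> k = 0 \<and>
        f = cst c5 * Lam^2 * (4 * Db^3 + 6 * Db^2 * Lam - Db * Lam^2 + cst Dbar * Lam^3)))
   \<or> (Dl = 1 \<and> Dbar = -4 \<and> (\<exists>c6. c6 \<noteq> 0 \<and> k = 0 \<and>
        f = cst c6 * (Db^4 * Lam^2 - 10 * Db^2 * Lam^4 - 17 * Db * Lam^5 - 8 * Lam^6)))
   \<or> ((\<exists>s \<in> {1, -1 :: complex}.
         Dl = 7/2 + s * complex_of_real (sqrt 19) / 2 \<and>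
         Dbar = -5/2 + s * complex_of_real (sqrt 19) / 2) \<and>
      (\<exists>c7. c7 \<noteq> 0 \<and> k = 0 \<and>
        f = cst c7 * (Db^4 * Lam^3 - cst (2 * Dbar + 3) * Db^3 * Lam^4
              - cst (3 * Dbar) * Db^2 * Lam^5 - cst (3 * Dbar + 1) * Db * Lam^6
              - cst (Dbar + 9/28) * Lam^7))))"

end

theory Submission
  imports Defs
begin

text \<open>
  The axioms for \<open>(N, M)\<close> and \<open>(N, Y)\<close> force \<open>g = h = 0\<close>, so an extension is a pair of a Virasoro cocycle
  \<open>f\<close> and a solution \<open>k\<close> of the \<open>(L, N)\<close>-equation, and equivalence changes \<open>f\<close> by a coboundary and leaves
  \<open>k\<close> fixed. The coefficient of \<open>\<mu>\<close> in the cocycle equation is an Euler equation: modulo coboundaries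
  \<open>f\<close> is homogeneous of degree \<open>n + 1\<close> in \<open>\<partial> + \<alpha>\<close> and \<open>\<lambda>\<close>, where \<open>n = \<Delta> - \<Delta>'\<close>
  (plus a constant if \<open>n = 0\<close>), and likewise \<open>k\<close> is homogeneous of
  degree \<open>n\<close>. For \<open>n \<ge> 1\<close> the coefficient of \<open>\<mu>\<^sup>2\<close> is a recursion that determines \<open>f\<close> from its coefficients at
  \<open>\<lambda>\<^sup>2\<close> and \<open>\<lambda>\<^sup>3\<close>, and one of these two dimensions is the coboundary of \<open>\<partial>\<^sup>n\<close>. So there is at most one
  class for each \<open>n\<close>. With \<open>v = 2 \<Delta>' + n - 1\<close>, for \<open>n \<ge> 5\<close> the relation at \<open>\<lambda>\<^sup>4 \<mu>\<^sup>3\<close> requires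
  \<open>v\<^sup>2 = 3 n + 1\<close>, and for \<open>n \<ge> 7\<close> the one at \<open>\<lambda>\<^sup>6 \<mu>\<^sup>3\<close> requires in addition \<open>v \<in> {0, 1, -1, 2, -2}\<close>, which is
  impossible. Similarly \<open>k\<close> is determined by its coefficient at \<open>\<lambda>\<close>, and two relations exclude \<open>n \<ge> 4\<close>.
\<close>

section \<open>Coefficients of polynomial identities\<close>

definition EV :: "bipoly \<Rightarrow> complex \<Rightarrow> complex \<Rightarrow> complex" where
  "EV f x l = poly (poly f [:l:]) x"

definition EV3 :: "complex poly poly poly \<Rightarrow> complex \<Rightarrow> complex \<Rightarrow> complex \<Rightarrow> complex" where
  "EV3 P x l m = EV (poly P [:[:m:]:]) x l"

lemma EV_simps [simp]:
  "EV 0 x l = 0" "EV (f + g) x l = EV f x l + EV g x l" "EV (- f) x l = - EV f x l"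
  "EV (f - g) x l = EV f x l - EV g x l" "EV (f * g) x l = EV f x l * EV g x l"
  "EV 1 x l = 1" "EV (pCons p f) x l = poly p x + l * EV f x l"
  "EV (monom p k) x l = poly p x * l ^ k" "EV (smult p f) x l = poly p x * EV f x l"
  "EV (f ^ k) x l = EV f x l ^ k" "EV (numeral w) x l = numeral w"
  by (simp_all add: EV_def poly_monom numeral_poly)

lemma EV3_simps [simp]:
  "EV3 0 x l m = 0" "EV3 (f + g) x l m = EV3 f x l m + EV3 g x l m"
  "EV3 (f - g) x l m = EV3 f x l m - EV3 g x l m" "EV3 (f * g) x l m = EV3 f x l m * EV3 g x l m"
  "EV3 (pCons p f) x l m = EV p x l + m * EV3 f x l m"
  "EV3 (smult p f) x l m = EV p x l * EV3 f x l m"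
  by (simp_all add: EV3_def)

text \<open>The constants \<open>c z\<close> are infinitely many roots, too many for a nonzero
  polynomial over a domain. Applied once per variable, this reduces equality of nested polynomials
  to equality of their complex values.\<close>

lemma poly_zero_if_const_roots:
  fixes p :: "'a::{comm_ring_1, ring_no_zero_divisors, ring_char_0} poly"
  assumes "inj c" "\<And>z :: complex. poly p (c z) = 0"
  shows "p = 0"
proof (rule ccontr)
  assume "p \<noteq> 0"
  then have "finite {x. poly p x = 0}" by (rule poly_roots_finite)
  moreover have "range c \<subseteq> {x. poly p x = 0}" using assms(2) by auto
  ultimately have "finite (range c)" by (rule rev_finite_subset)
  then show False using assms(1) finite_imageD infinite_UNIV_char_0 by blast
qed

lemma EV_eq_0: "(\<And>x l. EV f x l = 0) \<Longrightarrow> f = 0"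
  by (rule poly_zero_if_const_roots[of "\<lambda>z. [:z:]"])
    (auto simp: inj_def EV_def intro!: poly_zero_if_const_roots[of "\<lambda>z. z"])

lemma EV3_eq_0: "(\<And>x l m. EV3 f x l m = 0) \<Longrightarrow> f = 0"
  by (rule poly_zero_if_const_roots[of "\<lambda>z. [:[:z:]:]"])
    (auto simp: inj_def EV3_def intro!: EV_eq_0)

lemma EV_eqI: "(\<And>x l. EV f x l = EV g x l) \<Longrightarrow> f = g"
  using EV_eq_0[of "f - g"] by simp

definition cf :: "bipoly \<Rightarrow> nat \<Rightarrow> nat \<Rightarrow> complex" where
  "cf f p q = coeff (coeff f q) p"

lemma cf_simps [simp]:
  "cf 0 p q = 0" "cf (f + g) p q = cf f p q + cf g p q" "cf (f - g) p q = cf f p q - cf g p q"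
  "cf (smult [:c:] f) p q = c * cf f p q"
  "cf (monom (monom c i) j) p q = (if p = i \<and> q = j then c else 0)"
  by (simp_all add: cf_def)

lemma cf_eqI: "(\<And>p q. cf f p q = cf g p q) \<Longrightarrow> f = g"
  by (simp add: cf_def poly_eq_iff)

text \<open>\<open>p(u)\<close> is sent to \<open>p(u + v)\<close>, with the new variable \<open>v\<close> outermost.\<close>
definition add_var :: "'a::comm_ring_1 poly \<Rightarrow> 'a poly poly" where
  "add_var p = pcompose (map_poly (\<lambda>c. [:c:]) p) [:[:0, 1:], 1:]"

lemma add_var_0 [simp]: "add_var 0 = 0"
  by (simp add: add_var_def)

lemma add_var_pCons [simp]:
  "add_var (pCons a p) = [:[:a:]:] + [:[:0, 1:], 1:] * add_var p"
  by (simp add: add_var_def map_poly_pCons pcompose_pCons)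

lemma coeff_add_var: "coeff (coeff (add_var p) r) q = of_nat ((q + r) choose r) * coeff p (q + r)"
proof (induction p arbitrary: q r)
  case (pCons a p)
  \<comment> \<open>Multiplication by \<open>u + v\<close> raises one of the two exponents, so the
    binomial coefficients arise from Pascal's rule.\<close>
  have *: "[:[:0, 1:], 1:] * add_var p = pCons 0 (add_var p) + smult [:0, 1:] (add_var p)"
    by simp
  show ?case
    unfolding add_var_pCons *
    by (cases q; cases r)
      (auto simp: pCons.IH coeff_pCons algebra_simps split: nat.splits)
qed simp

lemma poly_add_var [simp]: "poly (poly (add_var p) [:m:]) l = poly p (l + m)"
  by (induction p) (simp_all add: algebra_simps)

definition lift :: "'a::comm_ring_1 poly \<Rightarrow> 'a poly poly" where
  "lift p = map_poly (\<lambda>c. [:c:]) p"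

lemma coeff_lift: "coeff (lift p) r = [:coeff p r:]"
  by (simp add: lift_def coeff_map_poly)

lemma lift_pCons [simp]: "lift (pCons a p) = pCons [:a:] (lift p)" "lift 0 = 0"
  by (simp_all add: lift_def map_poly_pCons)

text \<open>The coefficients are lifted to the outer variable and the result is evaluated at the
  inner one. For polynomials in \<open>x\<close>, \<open>l\<close>, \<open>m\<close> this exchanges
  \<open>l\<close> and \<open>m\<close>.\<close>

definition swap :: "'a::comm_ring_1 poly poly \<Rightarrow> 'a poly poly" where
  "swap P = poly (map_poly lift P) [:[:0, 1:]:]"

lemma swap_pCons [simp]: "swap (pCons c P) = lift c + [:[:0, 1:]:] * swap P" "swap 0 = 0"
  by (simp_all add: swap_def map_poly_pCons)

lemma coeff_swap: "coeff (coeff (swap P) q) r = coeff (coeff P r) q"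
  by (induction P arbitrary: r)
    (auto simp: coeff_lift coeff_pCons split: nat.splits)

lemma poly_lift [simp]: "poly (lift p) [:m:] = [:poly p m:]"
  by (induction p) (simp_all add: algebra_simps)

lemma EV_add_var [simp]: "EV (add_var p) x l = poly p (x + l)"
  by (simp add: EV_def)

lemma EV3_swap [simp]: "EV3 (swap P) x l m = EV3 P x m l"
proof -
  have 1: "EV3 (lift c) x l m = EV c x m" for c
    by (induction c) (simp_all)
  show ?thesis by (induction P) (simp_all add: 1)
qed

section \<open>Coefficient calculus for polynomial functions of three variables\<close>

definition has_coefs ::
    "(complex \<Rightarrow> complex \<Rightarrow> complex \<Rightarrow> complex) \<Rightarrow> (nat \<Rightarrow> nat \<Rightarrow> nat \<Rightarrow> complex) \<Rightarrow> bool" where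
  "has_coefs \<phi> c \<longleftrightarrow> (\<exists>P. (\<forall>x l m. EV3 P x l m = \<phi> x l m) \<and>
      (\<forall>p q r. coeff (coeff (coeff P r) q) p = c p q r))"

text \<open>\<open>has_coefs\<close> ties a function to its coefficients through a witness
  polynomial, so the coefficients of a composite expression can be assembled rule by rule. This
  lemma then extracts one scalar equation from an identity of functions.\<close>

lemma has_coefs_zero: "has_coefs (\<lambda>x l m. 0) c \<Longrightarrow> c p q r = 0"
  unfolding has_coefs_def using EV3_eq_0 by (metis coeff_0)

lemma has_coefs_add: "has_coefs \<phi> c \<Longrightarrow> has_coefs \<psi> d \<Longrightarrow>
    has_coefs (\<lambda>x l m. \<phi> x l m + \<psi> x l m) (\<lambda>p q r. c p q r + d p q r)"
  unfolding has_coefs_def by (metis EV3_simps(2) coeff_add)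

lemma has_coefs_diff: "has_coefs \<phi> c \<Longrightarrow> has_coefs \<psi> d \<Longrightarrow>
    has_coefs (\<lambda>x l m. \<phi> x l m - \<psi> x l m) (\<lambda>p q r. c p q r - d p q r)"
  unfolding has_coefs_def by (metis EV3_simps(3) coeff_diff)

lemma has_coefs_scale: "has_coefs \<phi> c \<Longrightarrow>
    has_coefs (\<lambda>x l m. z * \<phi> x l m) (\<lambda>p q r. z * c p q r)"
  unfolding has_coefs_def
  apply clarify
  subgoal for P by (rule exI[of _ "[:[:[:z:]:]:] * P"]) simp
  done

lemma has_coefs_x: "has_coefs \<phi> c \<Longrightarrow>
    has_coefs (\<lambda>x l m. x * \<phi> x l m) (\<lambda>p q r. if p = 0 then 0 else c (p - 1) q r)"
  unfolding has_coefs_def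
  apply clarify
  subgoal for P
    by (rule exI[of _ "[:[:[:0, 1:]:]:] * P"]) (auto simp: coeff_pCons split: nat.splits)
  done

lemma has_coefs_l: "has_coefs \<phi> c \<Longrightarrow>
    has_coefs (\<lambda>x l m. l * \<phi> x l m) (\<lambda>p q r. if q = 0 then 0 else c p (q - 1) r)"
  unfolding has_coefs_def
  apply clarify
  subgoal for P
    by (rule exI[of _ "[:[:0, 1:]:] * P"]) (auto simp: coeff_pCons split: nat.splits)
  done

lemma has_coefs_swap: "has_coefs \<phi> c \<Longrightarrow>
    has_coefs (\<lambda>x l m. \<phi> x m l) (\<lambda>p q r. c p r q)"
  unfolding has_coefs_def
  apply clarify
  subgoal for P by (rule exI[of _ "swap P"]) (simp add: coeff_swap)
  done

lemma has_coefs_m: "has_coefs \<phi> c \<Longrightarrow>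
    has_coefs (\<lambda>x l m. m * \<phi> x l m) (\<lambda>p q r. if r = 0 then 0 else c p q (r - 1))"
  by (drule has_coefs_swap, drule has_coefs_l, drule has_coefs_swap)

lemma has_coefs_EV: "has_coefs (\<lambda>x l m. EV f x l) (\<lambda>p q r. if r = 0 then cf f p q else 0)"
  unfolding has_coefs_def
  by (rule exI[of _ "[:f:]"]) (auto simp: cf_def coeff_pCons split: nat.splits)

lemma has_coefs_EV_sum:
  "has_coefs (\<lambda>x l m. EV f x (l + m)) (\<lambda>p q r. of_nat ((q + r) choose r) * cf f p (q + r))"
proof -
  have "EV3 (add_var f) x l m = EV f x (l + m)" for x l m
    by (induction f) (simp_all add: algebra_simps)
  then show ?thesis
    unfolding has_coefs_def cf_def
    by (intro exI[of _ "add_var f"])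
      (auto simp: coeff_add_var of_nat_poly)
qed

lemma has_coefs_EV_shift:
  "has_coefs (\<lambda>x l m. EV f (x + l) m) (\<lambda>p q r. of_nat ((p + q) choose q) * cf f (p + q) r)"
proof -
  have "EV3 (map_poly add_var f) x l m = EV f (x + l) m" for x l m
    by (induction f) (simp_all add: map_poly_pCons)
  then show ?thesis
    unfolding has_coefs_def cf_def
    by (intro exI[of _ "map_poly add_var f"]) (auto simp: coeff_add_var coeff_map_poly)
qed

section \<open>Virasoro cocycles\<close>

text \<open>The module axiom for the pairs \<open>(L, L)\<close> and \<open>(L, N)\<close>, in the variable \<open>x = \<partial> + \<alpha>\<close>.\<close>
definition cocycle :: "complex \<Rightarrow> complex \<Rightarrow> (complex \<Rightarrow> complex \<Rightarrow> complex) \<Rightarrow> bool" where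
  "cocycle Db Dl F \<longleftrightarrow> (\<forall>x l m.
     ((x + l + Dl * m) * F x l + (x + Db * l) * F (x + l) m)
     - ((x + m + Dl * l) * F x m + (x + Db * m) * F (x + m) l) = (l - m) * F x (l + m))"

definition current_cocycle :: "complex \<Rightarrow> complex \<Rightarrow> (complex \<Rightarrow> complex \<Rightarrow> complex) \<Rightarrow> bool" where
  "current_cocycle Db Dl K \<longleftrightarrow> (\<forall>x l m.
     (x + Db * l) * K (x + l) m - (x + m + Dl * l) * K x m = - m * K x (l + m))"

text \<open>The difference of two \<open>f\<close> related by an equivalence that sends the
  generator \<open>v_D\<close> to \<open>v_D\<close> plus a polynomial multiple of
  \<open>v_Dbar\<close>; that polynomial, in the variable \<open>x\<close>, is
  \<open>\<phi>\<close>.\<close>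

definition cob :: "complex \<Rightarrow> complex \<Rightarrow> complex poly \<Rightarrow> bipoly" where
  "cob Db Dl \<phi> = [:[:0, 1:], [:Dl:]:] * [:\<phi>:] - [:[:0, 1:], [:Db:]:] * add_var \<phi>"

lemma EV_cob [simp]: "EV (cob Db Dl \<phi>) x l = (x + Dl * l) * poly \<phi> x - (x + Db * l) * poly \<phi> (x + l)"
  by (simp add: cob_def algebra_simps)

lemma cocycle_cob: "cocycle Db Dl (EV (cob Db Dl \<phi>))"
  unfolding cocycle_def EV_cob by (simp add: algebra_simps)

lemma cocycle_comb:
  assumes "cocycle Db Dl (EV f)" "cocycle Db Dl (EV g)"
  shows "cocycle Db Dl (EV (f + smult [:c:] g))"
proof -
  \<comment> \<open>The defect of the cocycle equation, which is linear in \<open>F\<close>.\<close>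
  define D where "D F x l m = ((x + l + Dl * m) * F x l + (x + Db * l) * F (x + l) m)
     - ((x + m + Dl * l) * F x m + (x + Db * m) * F (x + m) l) - (l - m) * F x (l + m)"
    for F and x l m :: complex
  have "D (EV (f + smult [:c:] g)) x l m = D (EV f) x l m + c * D (EV g) x l m" for x l m
    by (simp add: D_def algebra_simps)
  moreover have "cocycle Db Dl F \<longleftrightarrow> (\<forall>x l m. D F x l m = 0)" for F
    by (simp only: cocycle_def D_def right_minus_eq)
  ultimately show ?thesis
    using assms by simp
qed

text \<open>For \<open>q \<ge> 1\<close> this is the coefficient of \<open>x^p l^q\<close> in
  \<open>(x + Db * l) * (x + l)^(p + q - 1)\<close>.\<close>

definition ecf :: "complex \<Rightarrow> nat \<Rightarrow> nat \<Rightarrow> complex" where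
  "ecf Db p q = of_nat ((p + q - 1) choose q) + Db * of_nat ((p + q - 1) choose (q - 1))"

text \<open>Coefficient of \<open>x^p l^q m^r\<close> in
  \<open>(x + l + Dl * m) * F x l + (x + Db * l) * F (x + l) m\<close>. The rest of the left side of
  the cocycle equation is the same expression with \<open>l\<close> and \<open>m\<close>
  exchanged.\<close>

definition cocycle_lhs_cf :: "complex \<Rightarrow> complex \<Rightarrow> bipoly \<Rightarrow> nat \<Rightarrow> nat \<Rightarrow> nat \<Rightarrow> complex" where
  "cocycle_lhs_cf Db Dl f p q r =
     (if p = 0 then 0 else if r = 0 then cf f (p - 1) q else 0)
   + (if q = 0 then 0 else if r = 0 then cf f p (q - 1) else 0)
   + Dl * (if r = 0 then 0 else if r - 1 = 0 then cf f p q else 0)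
   + (if p = 0 then 0 else of_nat ((p - 1 + q) choose q) * cf f (p - 1 + q) r)
   + Db * (if q = 0 then 0 else of_nat ((p + (q - 1)) choose (q - 1)) * cf f (p + (q - 1)) r)"

lemma cocycle_coefs:
  assumes "cocycle Db Dl (EV f)"
  shows "cocycle_lhs_cf Db Dl f p q r - cocycle_lhs_cf Db Dl f p r q =
     (if q = 0 then 0 else of_nat ((q - 1 + r) choose r) * cf f p (q - 1 + r))
   - (if r = 0 then 0 else of_nat ((q + (r - 1)) choose (r - 1)) * cf f p (q + (r - 1)))"
proof -
  define \<phi> where "\<phi> x l m = x * EV f x l + l * EV f x l + Dl * (m * EV f x l)
    + x * EV f (x + l) m + Db * (l * EV f (x + l) m)" for x l m
  have 1: "has_coefs \<phi> (cocycle_lhs_cf Db Dl f)"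
    unfolding \<phi>_def cocycle_lhs_cf_def
    by (intro has_coefs_add has_coefs_x has_coefs_l has_coefs_m has_coefs_scale
        has_coefs_EV has_coefs_EV_shift)
  have 2: "has_coefs (\<lambda>x l m. \<phi> x l m - \<phi> x m l) (\<lambda>p q r. cocycle_lhs_cf Db Dl f p q r - cocycle_lhs_cf Db Dl f p r q)"
    by (rule has_coefs_diff[OF 1 has_coefs_swap[OF 1]])
  have 3: "has_coefs (\<lambda>x l m. (\<phi> x l m - \<phi> x m l) -
      (l * EV f x (l + m) - m * EV f x (l + m)))
    (\<lambda>p q r. (cocycle_lhs_cf Db Dl f p q r - cocycle_lhs_cf Db Dl f p r q) - (
     (if q = 0 then 0 else of_nat ((q - 1 + r) choose r) * cf f p (q - 1 + r))
   - (if r = 0 then 0 else of_nat ((q + (r - 1)) choose (r - 1)) * cf f p (q + (r - 1)))))"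
    by (rule has_coefs_diff[OF 2 has_coefs_diff[OF has_coefs_l[OF has_coefs_EV_sum]
          has_coefs_m[OF has_coefs_EV_sum]]])
  have "(\<phi> x l m - \<phi> x m l) - (l * EV f x (l + m) - m * EV f x (l + m)) = 0" for x l m
    using assms[unfolded cocycle_def, rule_format, of x l m] unfolding \<phi>_def by algebra
  from has_coefs_zero[OF 3[unfolded this]] show ?thesis by simp
qed

text \<open>The factor \<open>Dl - Db - p\<close> at \<open>l\<close> is a resonance: a coboundary
  can remove the coefficient of \<open>x^p * l\<close> unless \<open>p = Dl - Db\<close>.\<close>

lemma cf_cob:
  "cf (cob Db Dl \<phi>) p q =
    (if q = 0 then 0 else if q = 1 then (Dl - Db - of_nat p) * coeff \<phi> p
     else - ecf Db p q * coeff \<phi> (p + q - 1))"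
proof -
  have *: "cob Db Dl \<phi> = [:pCons 0 \<phi>, smult Dl \<phi>:]
      - smult [:0, 1:] (add_var \<phi>) - pCons 0 (smult [:Db:] (add_var \<phi>))"
    by (simp add: cob_def)
  show ?thesis
    unfolding * cf_def
    by (cases p; cases q)
      (auto simp: coeff_add_var coeff_pCons ecf_def algebra_simps binomial_eq_0 split: nat.splits)
qed

lemma cocycle_lhs_cf_ge2: "q \<ge> 2 \<Longrightarrow> r \<ge> 2 \<Longrightarrow> cocycle_lhs_cf Db Dl f p q r = ecf Db p q * cf f (p + q - 1) r"
  by (cases p; cases q) (simp_all add: cocycle_lhs_cf_def ecf_def algebra_simps binomial_eq_0)

context
  fixes Db Dl :: complex and f :: bipoly
  assumes cocycle: "cocycle Db Dl (EV f)"
begin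

text \<open>In the coefficient of \<open>l^(i + 1)\<close> the term \<open>cf f 0 i\<close> occurs
  on both sides, and only \<open>Db * cf f i 0\<close> remains.\<close>

lemma cocycle_cf_0:
  assumes "Db \<noteq> 0" "i \<ge> 1"
  shows "cf f i 0 = 0"
  using cocycle_coefs[OF cocycle, of 0 "i + 1" 0] assms by (simp add: cocycle_lhs_cf_def)

lemma cocycle_cf_0_0: "(Db - Dl) * cf f 0 0 = 0"
  using cocycle_coefs[OF cocycle, of 0 1 0] by (simp add: cocycle_lhs_cf_def algebra_simps)

text \<open>The coefficient of \<open>m\<close> is an Euler equation: \<open>cf f p q\<close> is
  multiplied by the deviation of its degree from the resonant one, and the only other term is a
  coefficient at \<open>l\<close> of the same total degree.\<close>

lemma cocycle_cf_1:
  assumes "q \<ge> 2"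
  shows "(Dl - Db - of_nat (p + q - 1)) * cf f p q = - ecf Db p q * cf f (p + q - 1) 1"
  using cocycle_coefs[OF cocycle, of p q 1] assms
  by (cases p; cases q) (simp_all add: cocycle_lhs_cf_def ecf_def algebra_simps binomial_eq_0)

lemma cocycle_cf_ge2:
  assumes "q \<ge> 2" "r \<ge> 2"
  shows "ecf Db p q * cf f (p + q - 1) r - ecf Db p r * cf f (p + r - 1) q =
    (of_nat ((q + r - 1) choose r) - of_nat ((q + r - 1) choose (r - 1))) * cf f p (q + r - 1)"
  using cocycle_coefs[OF cocycle, of p q r] assms
  by (cases q; cases r) (simp_all add: cocycle_lhs_cf_ge2 algebra_simps)

end

section \<open>Reduction to homogeneous cocycles modulo coboundaries\<close>

definition homogeneous :: "nat \<Rightarrow> bipoly \<Rightarrow> bool" where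
  "homogeneous n f \<longleftrightarrow> (\<forall>p q. cf f p q \<noteq> 0 \<longrightarrow> p + q = n + 1 \<and> q \<ge> 2)"

text \<open>A coboundary removes the coefficients at \<open>l\<close> in all degrees except the
  resonant one. The Euler equation \<open>cocycle_cf_1\<close> then kills the coefficients at higher
  powers of \<open>l\<close> outside that degree.\<close>

lemma cocycle_reduce:
  assumes cocycle: "cocycle Db Dl (EV f)" and "Db \<noteq> 0"
  obtains \<phi> g where "f = cob Db Dl \<phi> + g" "cocycle Db Dl (EV g)"
    "\<And>p q. cf g p q \<noteq> 0 \<Longrightarrow>
      Dl - Db = of_nat (p + q) - 1 \<and> (q \<ge> 2 \<or> Dl = Db) \<or> p = 0 \<and> q = 0 \<and> Dl = Db"
proof -
  \<comment> \<open>The coboundary of \<open>x^d\<close> has the coefficient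
    \<open>Dl - Db - d\<close> at \<open>x^d * l\<close>. In the resonant degree nothing can be
    cancelled, and the default is 0.\<close>
  define s where "s d = (if Dl - Db = of_nat d then 0 else cf f d 1 / (Dl - Db - of_nat d))" for d
  define \<phi> where "\<phi> = (\<Sum>d\<le>degree (coeff f 1). monom (s d) d)"
  have \<phi>: "coeff \<phi> d = s d" for d
  proof (cases "d \<le> degree (coeff f 1)")
    case False
    then have "cf f d 1 = 0" by (simp add: cf_def coeff_eq_0)
    then show ?thesis using False by (simp add: \<phi>_def coeff_sum s_def)
  qed (simp add: \<phi>_def coeff_sum)
  define g where "g = f + smult [:-1:] (cob Db Dl \<phi>)"
  have "f = cob Db Dl \<phi> + g" by (rule cf_eqI) (simp add: g_def)
  moreover have cg: "cocycle Db Dl (EV g)"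
    unfolding g_def by (intro cocycle_comb cocycle cocycle_cob)
  moreover have "Dl - Db = of_nat (p + q) - 1 \<and> (q \<ge> 2 \<or> Dl = Db) \<or> p = 0 \<and> q = 0 \<and> Dl = Db"
    if "cf g p q \<noteq> 0" for p q
  proof -
    consider "q = 0" | "q = 1" | "q \<ge> 2" by linarith
    then show ?thesis
    proof cases
      case 1
      then have "p = 0" using cocycle_cf_0[OF cg \<open>Db \<noteq> 0\<close>, of p] that by force
      then show ?thesis using cocycle_cf_0_0[OF cg] that 1 by simp
    next
      case 2
      then have "cf g p q = cf f p 1 - (Dl - Db - of_nat p) * s p"
        by (simp add: g_def cf_cob \<phi>)
      then have "Dl - Db = of_nat p" using that by (auto simp: s_def split: if_splits)
      moreover have "Dl = Db" if "p \<noteq> 0"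
      proof -
        \<comment> \<open>At the resonance the left factor of the Euler equation is 0, while
          \<open>ecf Db 0 (p + 1)\<close> equals \<open>Db\<close>.\<close>
        have "ecf Db 0 (p + 1) * cf g p 1 = 0"
          using cocycle_cf_1[OF cg, of "p + 1" 0] that \<open>Dl - Db = of_nat p\<close> by simp
        moreover have "ecf Db 0 (p + 1) \<noteq> 0"
          using \<open>Db \<noteq> 0\<close> by (simp add: ecf_def binomial_eq_0)
        ultimately show ?thesis using \<open>cf g p q \<noteq> 0\<close> 2 by simp
      qed
      ultimately show ?thesis using 2 by (cases "p = 0") auto
    next
      case 3
      have "Dl - Db = of_nat (p + q - 1)"
      proof (rule ccontr)
        assume n: "Dl - Db \<noteq> of_nat (p + q - 1)"
        then have "cf g (p + q - 1) 1 = 0"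
          by (simp add: g_def cf_cob \<phi> s_def)
        with cocycle_cf_1[OF cg 3, of p] n that show False by simp
      qed
      then show ?thesis using 3 by (simp add: of_nat_diff)
    qed
  qed
  ultimately show ?thesis using that by blast
qed

text \<open>In \<open>cocycle_cf_ge2\<close> with \<open>p = n + 2 - q - r\<close> all coefficients
  have total degree \<open>n + 1\<close>, so the exponent of \<open>l\<close> alone indexes
  them.\<close>

lemma homogeneous_eq:
  assumes "cocycle Db Dl (EV f)" "q \<ge> 2" "r \<ge> 2" "q + r \<le> n + 2"
  shows "(of_nat ((n + 1 - r) choose q) + Db * of_nat ((n + 1 - r) choose (q - 1))) * cf f (n + 1 - r) r
    - (of_nat ((n + 1 - q) choose r) + Db * of_nat ((n + 1 - q) choose (r - 1))) * cf f (n + 1 - q) q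
    = (of_nat ((q + r - 1) choose r) - of_nat ((q + r - 1) choose (r - 1)))
       * cf f (n + 2 - q - r) (q + r - 1)"
proof -
  have "n + 2 - q - r + q - 1 = n + 1 - r" "n + 2 - q - r + r - 1 = n + 1 - q"
    using assms by auto
  then show ?thesis
    using cocycle_cf_ge2[OF assms(1-3), of "n + 2 - q - r"] by (simp add: ecf_def)
qed

text \<open>The relation for the pair \<open>(r, 2)\<close> yields the coefficient at
  \<open>l^(r + 1)\<close> from those at \<open>l^r\<close> and \<open>l^2\<close>. Its factor
  \<open>(r + 1 choose 2) - (r + 1)\<close> is nonzero from \<open>r = 3\<close> on, but is 0 at
  \<open>r = 2\<close>, which leaves the coefficient at \<open>l^3\<close> free.\<close>

lemma homogeneous_zero:
  assumes cocycle: "cocycle Db Dl (EV f)" and h: "homogeneous n f"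
    and 2: "n \<ge> 1 \<Longrightarrow> cf f (n - 1) 2 = 0" and 3: "n \<ge> 2 \<Longrightarrow> cf f (n - 2) 3 = 0"
  shows "f = 0"
proof -
  have "cf f (n + 1 - q) q = 0" if "q \<ge> 2" "q \<le> n + 1" for q
    using that
  proof (induction q rule: less_induct)
    case (less q)
    consider "q = 2" | "q = 3" | "q \<ge> 4" using less.prems by linarith
    then show ?case
    proof cases
      case 3
      define r where "r = q - 1"
      have r: "r \<ge> 3" "q = r + 1" "r \<le> n" using 3 less.prems by (auto simp: r_def)
      have z: "cf f (n + 1 - r) r = 0" "cf f (n + 1 - 2) 2 = 0"
        using less.IH[of r] less.IH[of 2] r less.prems by auto
      have "of_nat ((r + 1) choose 2) - of_nat (r + 1) \<noteq> (0 :: complex)"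
      proof -
        have "(r + 1) choose 2 > r + 1"
          using r(1) by (simp add: choose_two nat_le_iff_add) (auto simp: algebra_simps)
        then show ?thesis by (metis less_irrefl of_nat_eq_iff right_minus_eq)
      qed
      then show ?thesis
        using homogeneous_eq[OF cocycle, of r 2 n] r z by simp
    qed (use 2 3 less.prems in \<open>auto\<close>)
  qed
  then show ?thesis
    using h unfolding homogeneous_def by (intro cf_eqI) (metis add_diff_cancel_right' le_add2 cf_simps(1))
qed

section \<open>Relations between the coefficients, obtained by elimination\<close>

lemma of_nat_choose:
  fixes m :: nat
  shows "(of_nat (m choose 2) :: complex) = of_nat m * (of_nat m - 1) / 2"
    "(of_nat (m choose 3) :: complex) = of_nat m * (of_nat m - 1) * (of_nat m - 2) / 6"
    "(of_nat (m choose 4) :: complex) = of_nat m * (of_nat m - 1) * (of_nat m - 2) * (of_nat m - 3) / 24"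
    "(of_nat (m choose 5) :: complex) = of_nat m * (of_nat m - 1) * (of_nat m - 2) * (of_nat m - 3)
      * (of_nat m - 4) / 120"
    "(of_nat (m choose 6) :: complex) = of_nat m * (of_nat m - 1) * (of_nat m - 2) * (of_nat m - 3)
      * (of_nat m - 4) * (of_nat m - 5) / 720"
  by (simp_all add: binomial_gbinomial gbinomial_prod_rev eval_nat_numeral algebra_simps)

text \<open>Here \<open>a3\<close> to \<open>a6\<close> are the coefficients at \<open>l^3\<close>
  to \<open>l^6\<close>, the one at \<open>l^2\<close> being 0. The pairs \<open>(3, 2)\<close>,
  \<open>(4, 2)\<close>, \<open>(5, 2)\<close> express \<open>a6\<close> by \<open>a3\<close>; the
  pair \<open>(4, 3)\<close> determines \<open>a6\<close> once more, and the difference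
  factors.\<close>

lemma relation_4_3:
  fixes N B v a3 a4 a5 a6 :: complex
  assumes v: "v = 2 * B + N - 1"
  and "- ((N - 2) * (N - 3 + 2 * B) / 2) * a3 = 2 * a4"
  and "- ((N - 3) * (N - 4 + 2 * B) / 2) * a4 = 5 * a5"
  and "- ((N - 4) * (N - 5 + 2 * B) / 2) * a5 = 9 * a6"
  and "(N - 2) * (N - 3) * (N - 4) * (N - 5 + 4 * B) / 24 * a3
     - (N - 3) * (N - 4) * (N - 5 + 3 * B) / 6 * a4 = 5 * a6"
  shows "(N - 2) * (N - 3) * (N - 4) * (v * (v\<^sup>2 - 3 * N - 1)) * a3 = 0"
proof -
  define c where "c = (N - 2) * (N - 3) * (N - 4) * a3"
  have B: "N - 5 + 4 * B = 2 * v - N - 3" "N - 5 + 3 * B = (3 * v - N - 7) / 2"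
    "N - 3 + 2 * B = v - 2" "N - 4 + 2 * B = v - 3" "N - 5 + 2 * B = v - 4"
    unfolding v by (simp_all add: field_simps)
  note A = assms(2-5)[unfolded B]
  have 4: "a4 = - (N - 2) * (v - 2) / 4 * a3" using A(1) by algebra
  have 5: "a5 = (N - 2) * (N - 3) * (v - 2) * (v - 3) / 40 * a3"
    using A(2) unfolding 4 by algebra
  have 6: "a6 = - c * (v - 2) * (v - 3) * (v - 4) / 720"
    using A(3) unfolding 5 c_def by algebra
  have "(N - 3) * (N - 4) * ((3 * v - N - 7) / 2) / 6 * a4 = - c * (3 * v - N - 7) * (v - 2) / 48"
    unfolding 4 c_def by (simp add: field_simps)
  then have "c * (2 * v - N - 3) / 24 + c * (3 * v - N - 7) * (v - 2) / 48 = 5 * a6"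
    using A(4) unfolding c_def by (simp add: mult_ac)
  then have "c * (v * (v\<^sup>2 - 3 * N - 1)) = 0" unfolding 6 by algebra
  then show ?thesis unfolding c_def by (simp add: mult_ac)
qed

text \<open>The pairs \<open>(6, 2)\<close> and \<open>(7, 2)\<close> continue the recursion to
  \<open>a8\<close>, which \<open>(6, 3)\<close> determines once more. With
  \<open>N = (v^2 - 1) / 3\<close> the difference is a quintic in \<open>v\<close> that splits over
  the integers.\<close>

lemma relation_6_3:
  fixes N B v a3 a4 a5 a6 a7 a8 :: complex
  assumes v: "v = 2 * B + N - 1" and N: "v\<^sup>2 = 3 * N + 1"
  and "- ((N - 2) * (N - 3 + 2 * B) / 2) * a3 = 2 * a4"
  and "- ((N - 3) * (N - 4 + 2 * B) / 2) * a4 = 5 * a5"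
  and "- ((N - 4) * (N - 5 + 2 * B) / 2) * a5 = 9 * a6"
  and "- ((N - 5) * (N - 6 + 2 * B) / 2) * a6 = 14 * a7"
  and "- ((N - 6) * (N - 7 + 2 * B) / 2) * a7 = 20 * a8"
  and "(N - 2) * (N - 3) * (N - 4) * (N - 5) * (N - 6) * (N - 7 + 6 * B) / 720 * a3
     - (N - 5) * (N - 6) * (N - 7 + 3 * B) / 6 * a6 = 28 * a8"
  shows "(N - 2) * (N - 3) * (N - 4) * (N - 5) * (N - 6) * ((v - 2) * v * (v + 2) * (v - 1) * (v + 1)) * a3 = 0"
proof -
  define c where "c = (N - 2) * (N - 3) * (N - 4) * a3"
  define T where "T = (v - 2) * (v - 3) * (v - 4)"
  define K where "K = (N - 5) * (N - 6)"
  have B: "N - 7 + 6 * B = 3 * v - 2 * N - 4" "N - 7 + 3 * B = (3 * v - N - 11) / 2"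
    "N - 3 + 2 * B = v - 2" "N - 4 + 2 * B = v - 3" "N - 5 + 2 * B = v - 4"
    "N - 6 + 2 * B = v - 5" "N - 7 + 2 * B = v - 6"
    unfolding v by (simp_all add: field_simps)
  note A = assms(3-8)[unfolded B]
  have 4: "a4 = - (N - 2) * (v - 2) / 4 * a3" using A(1) by algebra
  have 5: "a5 = (N - 2) * (N - 3) * (v - 2) * (v - 3) / 40 * a3"
    using A(2) unfolding 4 by algebra
  have 6: "a6 = - c * T / 720"
    using A(3) unfolding 5 c_def T_def by algebra
  have 7: "a7 = c * T * (N - 5) * (v - 5) / 20160"
    using A(4) unfolding 6 by algebra
  have 8: "a8 = - c * T * K * (v - 5) * (v - 6) / 806400"
    using A(5) unfolding 7 K_def by algebra
  have "c * K * (3 * v - 2 * N - 4) / 720 - K * ((3 * v - N - 11) / 2) / 6 * a6 = 28 * a8"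
    using A(6) unfolding c_def K_def by (simp add: mult_ac)
  then have *: "(c * K) * (120 * (3 * v - 2 * N - 4) + 10 * T * (3 * v - N - 11)
      + 3 * T * (v - 5) * (v - 6)) = 0"
    unfolding 6 8 by algebra
  have N: "N = (v\<^sup>2 - 1) / 3" using N by simp
  have "- 3 * (120 * (3 * v - 2 * N - 4) + 10 * T * (3 * v - N - 11) + 3 * T * (v - 5) * (v - 6))
      = (v - 2) * v * (v + 2) * (v - 1) * (v + 1)"
    unfolding N T_def by algebra
  with * have "(c * K) * ((v - 2) * v * (v + 2) * (v - 1) * (v + 1)) = 0" by algebra
  then show ?thesis unfolding c_def K_def by (simp add: mult_ac)
qed

text \<open>The case \<open>v = 0\<close>: now \<open>a3\<close> is the coefficient normalised to 0
  and \<open>a2\<close> remains. The pairs are those of \<open>relation_4_3\<close>.\<close>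

lemma relation_4_3_degenerate:
  fixes N B a2 a4 a5 a6 :: complex
  assumes v: "2 * B + N - 1 = 0"
  and "(N - 1) * (N - 2) * (N - 3 + 3 * B) / 6 * a2 = 2 * a4"
  and "(N - 1) * (N - 2) * (N - 3) * (N - 4 + 4 * B) / 24 * a2 - ((N - 3) * (N - 4 + 2 * B) / 2) * a4 = 5 * a5"
  and "(N - 1) * (N - 2) * (N - 3) * (N - 4) * (N - 5 + 5 * B) / 120 * a2 - ((N - 4) * (N - 5 + 2 * B) / 2) * a5 = 9 * a6"
  and "- ((N - 3) * (N - 4) * (N - 5 + 3 * B) / 6) * a4 = 5 * a6"
  shows "(N - 1) * (N - 2) * (N - 3) * (N - 4) * ((N + 1) * (3 * N + 1)) * a2 = 0"
proof -
  define K where "K = (N - 1) * (N - 2) * a2"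
  define J where "J = K * (N - 3)"
  have B: "B = (1 - N) / 2" using v by algebra
  have Bs: "N - 3 + 3 * B = - (N + 3) / 2" "N - 4 + 4 * B = - (N + 2)" "N - 4 + 2 * B = - 3"
    "N - 5 + 5 * B = - (3 * N + 5) / 2" "N - 5 + 2 * B = - 4" "N - 5 + 3 * B = - (N + 7) / 2"
    unfolding B by (simp_all add: field_simps)
  note A = assms(2-5)[unfolded Bs]
  have 4: "a4 = - K * (N + 3) / 24" using A(1) unfolding K_def by algebra
  have "J * (- (N + 2)) / 24 - (N - 3) * (- 3) / 2 * a4 = 5 * a5"
    using A(2) unfolding J_def K_def by (simp add: mult_ac)
  moreover have "(N - 3) * (- 3) / 2 * a4 = J * (N + 3) / 16"
    unfolding 4 J_def by (simp add: field_simps)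
  ultimately have 5: "a5 = - J * (5 * N + 13) / 240" by algebra
  have "(J * (N - 4)) * (- (3 * N + 5) / 2) / 120 - (N - 4) * (- 4) / 2 * a5 = 9 * a6"
    using A(3) unfolding J_def K_def by (simp add: mult_ac)
  then have 6: "a6 = - (J * (N - 4)) * (13 * N + 31) / 2160"
    unfolding 5 by algebra
  have "- ((N - 3) * (N - 4) * (- (N + 7) / 2) / 6) * a4 = - (J * (N - 4)) * ((N + 7) * (N + 3)) / 288"
    unfolding 4 J_def by (simp add: field_simps)
  then have "- (J * (N - 4)) * ((N + 7) * (N + 3)) / 288 = 5 * a6"
    using A(4) by (simp only:)
  then have "(J * (N - 4)) * ((N + 1) * (3 * N + 1)) = 0"
    unfolding 6 by algebra
  then show ?thesis unfolding J_def K_def by (simp add: mult_ac)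
qed

text \<open>Closed forms of \<open>ecf\<close> for \<open>M = p + q - 1\<close>. The unevaluated
  \<open>2 - 1\<close> and the like match the \<open>q - 1\<close> in the premises of
  \<open>homogeneous_eq_explicit\<close>.\<close>

lemma ecf_numeral:
  fixes M :: nat and Db z :: complex
  assumes "of_nat M = z"
  shows "of_nat (M choose 2) + Db * of_nat (M choose (2 - 1)) = z * (z - 1 + 2 * Db) / 2"
    "of_nat (M choose 3) + Db * of_nat (M choose (3 - 1)) = z * (z - 1) * (z - 2 + 3 * Db) / 6"
    "of_nat (M choose 4) + Db * of_nat (M choose (4 - 1)) = z * (z - 1) * (z - 2) * (z - 3 + 4 * Db) / 24"
    "of_nat (M choose 5) + Db * of_nat (M choose (5 - 1)) =
      z * (z - 1) * (z - 2) * (z - 3) * (z - 4 + 5 * Db) / 120"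
    "of_nat (M choose 6) + Db * of_nat (M choose (6 - 1)) =
      z * (z - 1) * (z - 2) * (z - 3) * (z - 4) * (z - 5 + 6 * Db) / 720"
  using assms by (simp_all add: of_nat_choose field_simps)

lemma homogeneous_eq_explicit:
  assumes "cocycle Db Dl (EV f)" "q \<ge> 2" "r \<ge> 2" "q + r \<le> n + 2" "k = q + r - 1"
    "of_nat (k choose r) - of_nat (k choose (r - 1)) = (c :: complex)"
    "of_nat ((n + 1 - r) choose q) + Db * of_nat ((n + 1 - r) choose (q - 1)) = x"
    "of_nat ((n + 1 - q) choose r) + Db * of_nat ((n + 1 - q) choose (r - 1)) = y"
  shows "x * cf f (n + 1 - r) r - y * cf f (n + 1 - q) q = c * cf f (n + 1 - k) k"
proof -
  have "n + 1 - k = n + 2 - q - r" using assms by simp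
  then show ?thesis using homogeneous_eq[OF assms(1-4)] assms(5-8) by simp
qed

text \<open>At the resonance the coboundary of \<open>x^n\<close> has no term in \<open>l\<close>,
  so only \<open>l^2\<close> and higher powers remain.\<close>

lemma homogeneous_cob: "Dl = Db + of_nat n \<Longrightarrow> n \<ge> 1 \<Longrightarrow> homogeneous n (cob Db Dl (monom 1 n))"
  by (auto simp: homogeneous_def cf_cob split: if_splits)

lemma homogeneous_comb: "homogeneous n f \<Longrightarrow> homogeneous n g \<Longrightarrow> homogeneous n (f + smult [:c:] g)"
  unfolding homogeneous_def by (auto, (metis add.right_neutral mult_zero_right)+)

lemma smult_cancel: "f + smult [:- c:] g = 0 \<Longrightarrow> f = smult [:c:] (g :: bipoly)"
  by (simp add: eq_neg_iff_add_eq_0[symmetric] flip: smult_minus_left)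

lemma cf_cob_monom:
  assumes "Dl = Db + of_nat n"
  shows "n \<ge> 1 \<Longrightarrow> cf (cob Db Dl (monom 1 n)) (n - 1) 2 = - (of_nat n * (2 * Db + of_nat n - 1) / 2)"
    "n \<ge> 2 \<Longrightarrow> cf (cob Db Dl (monom 1 n)) (n - 2) 3
      = - (of_nat n * (of_nat n - 1) * (of_nat n - 2 + 3 * Db) / 6)"
  using assms by (simp_all add: cf_cob ecf_def of_nat_choose field_simps)

text \<open>Put \<open>v = 2 Db + n - 1\<close>. Since the coboundary of \<open>\<partial>\<^sup>n\<close> has \<open>\<lambda>\<^sup>2\<close>-coefficient \<open>- n v / 2\<close>, one of the
  two free coefficients \<open>a\<^sub>2\<close>, \<open>a\<^sub>3\<close> can be removed: \<open>a\<^sub>2\<close> if \<open>v \<noteq> 0\<close>, and \<open>a\<^sub>3\<close> otherwise. The relations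
  at \<open>\<lambda>\<^sup>4 \<mu>\<^sup>3\<close> and (for \<open>n \<ge> 7\<close>) \<open>\<lambda>\<^sup>6 \<mu>\<^sup>3\<close> then decide whether the other one vanishes.\<close>
lemma homogeneous_ge_5:
  assumes cocycle: "cocycle Db Dl (EV f)" and homogeneous: "homogeneous n f" and n: "Dl = Db + of_nat n" "n \<ge> 5"
    and special: "n \<le> 6 \<Longrightarrow> (2 * Db + of_nat n - 1)\<^sup>2 \<noteq> 3 * of_nat n + 1"
  shows "\<exists>s. f = smult [:s:] (cob Db Dl (monom 1 n))"
proof -
  define N :: complex where "N = of_nat n"
  define v where "v = 2 * Db + N - 1"
  define W where "W = cob Db Dl (monom 1 n)"
  have W: "cocycle Db Dl (EV W)" "homogeneous n W"
    using n by (auto simp: W_def cocycle_cob intro: homogeneous_cob)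
  have N: "N \<noteq> of_nat k" if "k < n" for k
    using that by (simp add: N_def)
  have N1: "N - 1 \<noteq> 0" "N - 2 \<noteq> 0" "N - 3 \<noteq> 0" "N - 4 \<noteq> 0" "N \<noteq> 0"
    using N[of 1] N[of 2] N[of 3] N[of 4] N[of 0] n by auto
  have N2: "N - 5 \<noteq> 0" "N - 6 \<noteq> 0" if "n \<ge> 7"
    using N[of 5] N[of 6] that by auto
  have zero: "g = 0" if "cocycle Db Dl (EV g)" "homogeneous n g" "cf g (n + 1 - 2) 2 = 0" "cf g (n + 1 - 3) 3 = 0" for g
    using that by (intro homogeneous_zero[of Db Dl g n]) auto
  have Npos: "N + 1 \<noteq> 0" "3 * N + 1 \<noteq> 0"
    unfolding N_def by (metis of_nat_Suc of_nat_0 of_nat_eq_iff nat.distinct(1) add.commute,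
      metis of_nat_Suc of_nat_0 of_nat_eq_iff nat.distinct(1) add.commute of_nat_mult of_nat_numeral)
  have M: "of_nat (n + 1 - 2) = N - 1" "of_nat (n + 1 - 3) = N - 2" "of_nat (n + 1 - 4) = N - 3"
    "of_nat (n + 1 - 5) = N - 4"
    using n by (simp_all add: N_def of_nat_diff)
  have M2: "of_nat (n + 1 - 6) = N - 5" "of_nat (n + 1 - 7) = N - 6" if "n \<ge> 7"
    using that by (simp_all add: N_def of_nat_diff)
  show ?thesis
  proof (cases "v = 0")
    case True
    \<comment> \<open>The coefficients of \<open>W\<close> at \<open>l^2\<close> and
      \<open>l^3\<close> are \<open>- N * v / 2 = 0\<close> and \<open>- E\<close>.\<close>
    define E where "E = N * (N - 1) * (N - 2 + 3 * Db) / 6"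
    have "E = - N * (N - 1) * (N + 1) / 12"
      using True unfolding E_def v_def by algebra
    then have "E \<noteq> 0" using N1 Npos by simp
    \<comment> \<open>This multiple of \<open>W\<close> cancels the coefficient at
      \<open>l^3\<close>. The outer minus sign gives the shape of
      \<open>smult_cancel\<close>.\<close>
    define g where "g = f + smult [:- (- cf f (n - 2) 3 / E):] W"
    have g: "cocycle Db Dl (EV g)" "homogeneous n g"
      unfolding g_def by (intro cocycle_comb homogeneous_comb cocycle homogeneous W)+
    define a where "a q = cf g (n + 1 - q) q" for q
    have a3: "a 3 = 0"
      using cf_cob_monom(2)[OF n(1)] n \<open>E \<noteq> 0\<close> by (simp add: a_def g_def W_def E_def N_def)
    note eq = homogeneous_eq_explicit[OF g(1), of _ _ n, folded a_def]
    have 1: "(N - 1) * (N - 1 - 1) * (N - 1 - 2 + 3 * Db) / 6 * a 2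
      - (N - 2) * (N - 2 - 1 + 2 * Db) / 2 * a 3 = 2 * a 4"
      by (rule eq[OF _ _ _ _ _ ecf_numeral(2) ecf_numeral(1)])
        (use n M in \<open>simp_all add: numeral_eq_Suc\<close>)
    have 2: "(N - 1) * (N - 1 - 1) * (N - 1 - 2) * (N - 1 - 3 + 4 * Db) / 24 * a 2
      - (N - 3) * (N - 3 - 1 + 2 * Db) / 2 * a 4 = 5 * a 5"
      by (rule eq[OF _ _ _ _ _ ecf_numeral(3) ecf_numeral(1)])
        (use n M in \<open>simp_all add: numeral_eq_Suc\<close>)
    have 3: "(N - 1) * (N - 1 - 1) * (N - 1 - 2) * (N - 1 - 3) * (N - 1 - 4 + 5 * Db) / 120 * a 2
      - (N - 4) * (N - 4 - 1 + 2 * Db) / 2 * a 5 = 9 * a 6"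
      by (rule eq[OF _ _ _ _ _ ecf_numeral(4) ecf_numeral(1)])
        (use n M in \<open>simp_all add: numeral_eq_Suc\<close>)
    have 4: "(N - 2) * (N - 2 - 1) * (N - 2 - 2) * (N - 2 - 3 + 4 * Db) / 24 * a 3
      - (N - 3) * (N - 3 - 1) * (N - 3 - 2 + 3 * Db) / 6 * a 4 = 5 * a 6"
      by (rule eq[OF _ _ _ _ _ ecf_numeral(3) ecf_numeral(2)])
        (use n M in \<open>simp_all add: numeral_eq_Suc\<close>)
    have "(N - 1) * (N - 2) * (N - 3) * (N - 4) * ((N + 1) * (3 * N + 1)) * a 2 = 0"
      by (rule relation_4_3_degenerate[of Db N "a 2" "a 4" "a 5" "a 6"]) (use 1 2 3 4 a3 True v_def in \<open>simp_all\<close>)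
    then have "a 2 = 0" using N1 Npos by simp
    then have "g = 0" using zero[OF g] a3 by (simp add: a_def)
    then show ?thesis unfolding W_def[symmetric] g_def by (blast dest: smult_cancel)
  next
    case False
    \<comment> \<open>Now \<open>W\<close> has the nonzero coefficient \<open>- N * v / 2\<close> at
      \<open>l^2\<close>, and the coefficient of \<open>f\<close> there is cancelled.\<close>
    define g where "g = f + smult [:- (- cf f (n - 1) 2 / (N * v / 2)):] W"
    have g: "cocycle Db Dl (EV g)" "homogeneous n g"
      unfolding g_def by (intro cocycle_comb homogeneous_comb cocycle homogeneous W)+
    define a where "a q = cf g (n + 1 - q) q" for q
    have a2: "a 2 = 0"
    proof -
      have "cf W (n - 1) 2 = - (N * v / 2)"
        using cf_cob_monom(1)[OF n(1)] n by (simp add: W_def v_def N_def algebra_simps)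
      then show ?thesis using False N1 by (simp add: a_def g_def)
    qed
    note eq = homogeneous_eq_explicit[OF g(1), of _ _ n, folded a_def]
    have 1: "(N - 1) * (N - 1 - 1) * (N - 1 - 2 + 3 * Db) / 6 * a 2
      - (N - 2) * (N - 2 - 1 + 2 * Db) / 2 * a 3 = 2 * a 4"
      by (rule eq[OF _ _ _ _ _ ecf_numeral(2) ecf_numeral(1)])
        (use n M in \<open>simp_all add: numeral_eq_Suc\<close>)
    have 2: "(N - 1) * (N - 1 - 1) * (N - 1 - 2) * (N - 1 - 3 + 4 * Db) / 24 * a 2
      - (N - 3) * (N - 3 - 1 + 2 * Db) / 2 * a 4 = 5 * a 5"
      by (rule eq[OF _ _ _ _ _ ecf_numeral(3) ecf_numeral(1)])
        (use n M in \<open>simp_all add: numeral_eq_Suc\<close>)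
    have 3: "(N - 1) * (N - 1 - 1) * (N - 1 - 2) * (N - 1 - 3) * (N - 1 - 4 + 5 * Db) / 120 * a 2
      - (N - 4) * (N - 4 - 1 + 2 * Db) / 2 * a 5 = 9 * a 6"
      by (rule eq[OF _ _ _ _ _ ecf_numeral(4) ecf_numeral(1)])
        (use n M in \<open>simp_all add: numeral_eq_Suc\<close>)
    have 4: "(N - 2) * (N - 2 - 1) * (N - 2 - 2) * (N - 2 - 3 + 4 * Db) / 24 * a 3
      - (N - 3) * (N - 3 - 1) * (N - 3 - 2 + 3 * Db) / 6 * a 4 = 5 * a 6"
      by (rule eq[OF _ _ _ _ _ ecf_numeral(3) ecf_numeral(2)])
        (use n M in \<open>simp_all add: numeral_eq_Suc\<close>)
    have *: "(N - 2) * (N - 3) * (N - 4) * (v * (v\<^sup>2 - 3 * N - 1)) * a 3 = 0"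
      by (rule relation_4_3[of v Db N "a 3" "a 4" "a 5" "a 6"]) (use 1 2 3 4 a2 v_def in \<open>simp_all\<close>)
    have "a 3 = 0"
    proof (rule ccontr)
      assume "a 3 \<noteq> 0"
      then have "v\<^sup>2 - 3 * N - 1 = 0" using * False N1 by simp
      then have v2: "v\<^sup>2 = 3 * N + 1" by (simp add: algebra_simps)
      \<comment> \<open>The hypothesis \<open>special\<close> rules out this equation for
        \<open>n \<le> 6\<close>, so the coefficients up to \<open>l^8\<close> are
        available.\<close>
      with special have n7: "n \<ge> 7" unfolding v_def N_def by linarith
      have 5: "(N - 1) * (N - 1 - 1) * (N - 1 - 2) * (N - 1 - 3) * (N - 1 - 4) * (N - 1 - 5 + 6 * Db) / 720 * a 2
        - (N - 5) * (N - 5 - 1 + 2 * Db) / 2 * a 6 = 14 * a 7"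
        by (rule eq[OF _ _ _ _ _ ecf_numeral(5) ecf_numeral(1)])
          (use n n7 M M2[OF n7] in \<open>simp_all add: numeral_eq_Suc\<close>)
      \<comment> \<open>The factor of \<open>a 2\<close> stays unevaluated because
        \<open>a 2 = 0\<close>.\<close>
      have 6: "(of_nat ((n + 1 - 2) choose 7) + Db * of_nat ((n + 1 - 2) choose (7 - 1))) * a 2
        - (N - 6) * (N - 6 - 1 + 2 * Db) / 2 * a 7 = 20 * a 8"
        by (rule eq[OF _ _ _ _ _ refl ecf_numeral(1)])
          (use n n7 M M2[OF n7] in \<open>simp_all add: numeral_eq_Suc\<close>)
      have 7: "(N - 2) * (N - 2 - 1) * (N - 2 - 2) * (N - 2 - 3) * (N - 2 - 4) * (N - 2 - 5 + 6 * Db) / 720 * a 3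
        - (N - 5) * (N - 5 - 1) * (N - 5 - 2 + 3 * Db) / 6 * a 6 = 28 * a 8"
        by (rule eq[OF _ _ _ _ _ ecf_numeral(5) ecf_numeral(2)])
          (use n n7 M M2[OF n7] in \<open>simp_all add: numeral_eq_Suc\<close>)
      have "(N - 2) * (N - 3) * (N - 4) * (N - 5) * (N - 6)
          * ((v - 2) * v * (v + 2) * (v - 1) * (v + 1)) * a 3 = 0"
        by (rule relation_6_3[of v Db N "a 3" "a 4" "a 5" "a 6" "a 7" "a 8"])
          (use 1 2 3 5 6 7 a2 v_def v2 in \<open>simp_all\<close>)
      then have "(v - 2) * (v + 2) * ((v - 1) * (v + 1)) = 0"
        using N1 N2[OF n7] False \<open>a 3 \<noteq> 0\<close> by simp
      \<comment> \<open>So \<open>v^2\<close> is 4 or 1, and \<open>N = (v^2 - 1) / 3\<close> is 1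
        or 0.\<close>
      then have "(v\<^sup>2 - 4) * (v\<^sup>2 - 1) = 0" by algebra
      then have "N = 1 \<or> N = 0" unfolding v2 by auto
      then show False using N1 by auto
    qed
    then have "g = 0" using zero[OF g] a2 by (simp add: a_def)
    then show ?thesis unfolding W_def[symmetric] g_def by (blast dest: smult_cancel)
  qed
qed

section \<open>Explicit cocycles and the classification in positive degree\<close>

definition mono2 :: "complex \<Rightarrow> nat \<Rightarrow> nat \<Rightarrow> bipoly" where
  "mono2 c p q = monom (monom c p) q"

lemma EV_mono2 [simp]: "EV (mono2 c p q) x l = c * x ^ p * l ^ q"
  by (simp add: mono2_def poly_monom)

lemma cf_mono2 [simp]: "cf (mono2 c i j) p q = (if p = i \<and> q = j then c else 0)"
  by (simp add: mono2_def)

text \<open>For \<open>n = 5\<close> and \<open>n = 6\<close> the guards come from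
  \<open>v^2 = 3 * n + 1\<close> with \<open>v = 2 * Db + n - 1\<close>; at \<open>n = 5\<close> the
  other solution is \<open>Db = 0\<close>. For \<open>n \<ge> 1\<close> and
  \<open>Db \<noteq> 0\<close> the value 0 signifies that all homogeneous cocycles of this degree
  are coboundaries.\<close>

definition fform :: "complex \<Rightarrow> nat \<Rightarrow> bipoly" where
  "fform Db n =
    (if n = 2 then mono2 2 1 2 + mono2 1 0 3
     else if n = 3 then mono2 1 2 2 + mono2 1 1 3
     else if n = 4 then mono2 4 3 2 + mono2 6 2 3 + mono2 (-1) 1 4 + mono2 Db 0 5
     else if n = 5 \<and> Db = -4 then mono2 1 4 2 + mono2 (-10) 2 4 + mono2 (-17) 1 5 + mono2 (-8) 0 6
     else if n = 6 \<and> (2 * Db + 5)\<^sup>2 = 19 then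
       mono2 1 4 3 + mono2 (- (2 * Db + 3)) 3 4 + mono2 (- (3 * Db)) 2 5
       + mono2 (- (3 * Db + 1)) 1 6 + mono2 (- (Db + 9 / 28)) 0 7
     else 0)"

lemma homogeneous_fform: "homogeneous n (fform Db n)"
  by (auto simp: homogeneous_def fform_def split: if_splits)

lemma cocycle_2: "cocycle Db (Db + 2) (\<lambda>x l. 2 * x * l ^ 2 + l ^ 3)"
  unfolding cocycle_def by algebra
lemma cocycle_3: "cocycle Db (Db + 3) (\<lambda>x l. x ^ 2 * l ^ 2 + x * l ^ 3)"
  unfolding cocycle_def by algebra
lemma cocycle_4: "cocycle Db (Db + 4) (\<lambda>x l. 4 * x ^ 3 * l ^ 2 + 6 * x ^ 2 * l ^ 3 - x * l ^ 4 + Db * l ^ 5)"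
  unfolding cocycle_def by algebra
lemma cocycle_5: "cocycle (-4) 1 (\<lambda>x l. x ^ 4 * l ^ 2 - 10 * x ^ 2 * l ^ 4 - 17 * x * l ^ 5 - 8 * l ^ 6)"
  unfolding cocycle_def by algebra
lemma cocycle_6:
  assumes "(2 * Db + 5)\<^sup>2 = 19"
  shows "cocycle Db (Db + 6) (\<lambda>x l. x ^ 4 * l ^ 3 - (2 * Db + 3) * x ^ 3 * l ^ 4 - 3 * Db * x ^ 2 * l ^ 5
    - (3 * Db + 1) * x * l ^ 6 - (Db + 9 / 28) * l ^ 7)" (is "cocycle _ _ ?F")
proof -
  have "2 * (2 * Db ^ 2 + 10 * Db + 3) = (2 * Db + 5)\<^sup>2 - 19" by algebra
  then have 0: "2 * Db ^ 2 + 10 * Db + 3 = 0"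
    unfolding assms by (metis diff_self mult_eq_0_iff zero_neq_numeral)
  \<comment> \<open>The defect of \<open>?F\<close> divided by
    \<open>2 * Db ^ 2 + 10 * Db + 3\<close> is antisymmetric in \<open>l\<close> and
    \<open>m\<close>; \<open>q\<close> collects its terms with the higher power of
    \<open>l\<close>.\<close>
  define q where "q x l m = 3 * x * l ^ 4 * m ^ 3 + 3 / 2 * l ^ 5 * m ^ 3 + 3 * x ^ 2 * l ^ 4 * m ^ 2
      + 3 * x * l ^ 5 * m ^ 2 + 3 / 2 * l ^ 6 * m ^ 2" for x l m :: complex
  have "((x + l + (Db + 6) * m) * ?F x l + (x + Db * l) * ?F (x + l) m)
     - ((x + m + (Db + 6) * l) * ?F x m + (x + Db * m) * ?F (x + m) l) - (l - m) * ?F x (l + m)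
     = (2 * Db ^ 2 + 10 * Db + 3) * (q x l m - q x m l)" for x l m
    unfolding q_def by algebra
  then show ?thesis unfolding cocycle_def 0 by simp
qed

lemma cocycle_fform: "cocycle Db (Db + of_nat n) (EV (fform Db n))"
proof -
  consider "n = 2" | "n = 3" | "n = 4" | "n = 5" "Db = -4" | "n = 6" "(2 * Db + 5)\<^sup>2 = 19"
    | "fform Db n = 0"
    unfolding fform_def by argo
  then show ?thesis
  proof cases
    case 1
    then have "EV (fform Db n) = (\<lambda>x l. 2 * x * l ^ 2 + l ^ 3)"
      by (intro ext) (simp add: fform_def)
    then show ?thesis using cocycle_2 1 by simp
  next
    case 2
    then have "EV (fform Db n) = (\<lambda>x l. x ^ 2 * l ^ 2 + x * l ^ 3)"
      by (intro ext) (simp add: fform_def)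
    then show ?thesis using cocycle_3 2 by simp
  next
    case 3
    then have "EV (fform Db n) =
        (\<lambda>x l. 4 * x ^ 3 * l ^ 2 + 6 * x ^ 2 * l ^ 3 - x * l ^ 4 + Db * l ^ 5)"
      by (intro ext) (simp add: fform_def)
    then show ?thesis using cocycle_4 3 by simp
  next
    case 4
    then have "EV (fform Db n) =
        (\<lambda>x l. x ^ 4 * l ^ 2 - 10 * x ^ 2 * l ^ 4 - 17 * x * l ^ 5 - 8 * l ^ 6)"
      by (intro ext) (simp add: fform_def)
    then show ?thesis using cocycle_5 4 by simp
  next
    case 5
    then have "EV (fform Db n) = (\<lambda>x l. x ^ 4 * l ^ 3 - (2 * Db + 3) * x ^ 3 * l ^ 4
        - 3 * Db * x ^ 2 * l ^ 5 - (3 * Db + 1) * x * l ^ 6 - (Db + 9 / 28) * l ^ 7)"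
      by (intro ext) (simp add: fform_def algebra_simps)
    then show ?thesis using cocycle_6[OF 5(2)] 5 by simp
  qed (simp add: cocycle_def)
qed

text \<open>The determinant of the coefficients at \<open>l^2\<close> and \<open>l^3\<close> makes
  the coboundary of \<open>x^n\<close> and \<open>fform Db n\<close> independent. By
  \<open>homogeneous_zero\<close> they then span the homogeneous cocycles, and
  \<open>fform Db n\<close> is not a coboundary.\<close>

lemma cob_fform_det:
  assumes "fform Db n \<noteq> 0" "Dl = Db + of_nat n"
  defines "W \<equiv> cob Db Dl (monom 1 n)"
  shows "n \<ge> 2" "cf W (n - 1) 2 * cf (fform Db n) (n - 2) 3 - cf W (n - 2) 3 * cf (fform Db n) (n - 1) 2 \<noteq> 0"
proof -
  consider "n = 2" | "n = 3" | "n = 4" | "n = 5" "Db = -4" | "n = 6" "(2 * Db + 5)\<^sup>2 = 19"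
    using assms(1) unfolding fform_def by argo
  note cases = this
  show n: "n \<ge> 2" using cases by cases auto
  have W: "cf W (n - 1) 2 = - (of_nat n * (2 * Db + of_nat n - 1) / 2)"
     "cf W (n - 2) 3 = - (of_nat n * (of_nat n - 1) * (of_nat n - 2 + 3 * Db) / 6)"
    using cf_cob_monom[OF assms(2)] n unfolding W_def by auto
  from cases show "cf W (n - 1) 2 * cf (fform Db n) (n - 2) 3 - cf W (n - 2) 3 * cf (fform Db n) (n - 1) 2 \<noteq> 0"
  proof cases
    case 5
    then have "2 * Db + 5 \<noteq> 0" by auto
    moreover have "30 + 12 * Db = 6 * (2 * Db + 5)" by simp
    ultimately have "30 + 12 * Db \<noteq> 0" by (metis mult_eq_0_iff zero_neq_numeral)
    then show ?thesis unfolding W using 5 by (simp add: fform_def)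
  qed (unfold W, simp_all add: fform_def field_simps)
qed

lemma homogeneous_classification:
  assumes cocycle: "cocycle Db Dl (EV f)" and homogeneous: "homogeneous n f" and n: "Dl = Db + of_nat n" "n \<ge> 1"
    and "Db \<noteq> 0"
  shows "\<exists>s c. f = smult [:s:] (cob Db Dl (monom 1 n)) + smult [:c:] (fform Db n)"
proof -
  define W where "W = cob Db Dl (monom 1 n)"
  have W: "cocycle Db Dl (EV W)" "homogeneous n W"
    using n by (auto simp: W_def cocycle_cob intro: homogeneous_cob)
  have F: "cocycle Db Dl (EV (fform Db n))" "homogeneous n (fform Db n)"
    using n cocycle_fform homogeneous_fform by auto
  show ?thesis
  proof (cases "fform Db n = 0")
    case False
    define b2 b3 c2 c3 a2 a3 where d: "b2 = cf W (n - 1) 2" "b3 = cf W (n - 2) 3"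
      "c2 = cf (fform Db n) (n - 1) 2" "c3 = cf (fform Db n) (n - 2) 3"
      "a2 = cf f (n - 1) 2" "a3 = cf f (n - 2) 3"
    have det: "b2 * c3 - b3 * c2 \<noteq> 0"
      using cob_fform_det[OF False n(1)] by (simp add: d W_def)
    \<comment> \<open>Cramer's rule for the combination that agrees with \<open>f\<close> at
      \<open>l^2\<close> and \<open>l^3\<close>.\<close>
    define s c where "s = (a2 * c3 - a3 * c2) / (b2 * c3 - b3 * c2)"
      and "c = (b2 * a3 - b3 * a2) / (b2 * c3 - b3 * c2)"
    have sc: "a2 = s * b2 + c * c2" "a3 = s * b3 + c * c3"
      using det by (simp_all add: s_def c_def divide_simps) (simp_all add: algebra_simps)
    define g where "g = f + smult [:-s:] W + smult [:-c:] (fform Db n)"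
    have "cocycle Db Dl (EV g)" "homogeneous n g"
      unfolding g_def by (intro cocycle_comb homogeneous_comb cocycle homogeneous W F)+
    moreover have "cf g (n - 1) 2 = 0" "cf g (n - 2) 3 = 0"
      using sc unfolding g_def cf_simps d by algebra+
    ultimately have "g = 0" by (rule homogeneous_zero)
    then have "f = smult [:s:] W + smult [:c:] (fform Db n)"
      unfolding g_def by (simp add: algebra_simps poly_eq_iff)
    then show ?thesis unfolding W_def by blast
  next
    case True
    have "\<exists>s. f = smult [:s:] W"
    proof (cases "n \<ge> 5")
      case 5: True
      have "(2 * Db + of_nat n - 1)\<^sup>2 \<noteq> 3 * of_nat n + 1" if "n \<le> 6"
      proof
        assume *: "(2 * Db + of_nat n - 1)\<^sup>2 = 3 * of_nat n + 1"
        consider "n = 5" | "n = 6" using \<open>n \<le> 6\<close> 5 by linarith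
        then show False
        proof cases
          case 1
          \<comment> \<open>The equation \<open>(2 * Db + 4)^2 = 16\<close> leaves
            \<open>Db = 0\<close> and \<open>Db = -4\<close>; in the second case
            \<open>fform\<close> is nonzero.\<close>
          then have "4 * (Db * (Db + 4)) = 0" using * by (simp add: power2_eq_square algebra_simps)
          then have "Db = -4" using \<open>Db \<noteq> 0\<close> by (simp add: eq_neg_iff_add_eq_0)
          then have "cf (fform Db n) 4 2 = 1" using 1 by (simp add: fform_def)
          then show False using True by simp
        next
          case 2
          then have "(2 * Db + 5)\<^sup>2 = 19" using * by (simp add: add.commute)
          then have "cf (fform Db n) 4 3 = 1" using 2 by (simp add: fform_def)
          then show False using True by simp
        qed
      qed
      then show ?thesis using homogeneous_ge_5[OF cocycle homogeneous n(1) 5] unfolding W_def by blast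
    next
      case False
      have "n = 1"
      proof (rule ccontr)
        assume "n \<noteq> 1"
        with False n have "n = 2 \<or> n = 3 \<or> n = 4" by auto
        moreover have "cf (fform Db n) (n - 1) 2 = 0" using True by simp
        ultimately show False by (auto simp: fform_def)
      qed
      \<comment> \<open>In degree \<open>n = 1\<close> only \<open>l^2\<close> occurs, and the
        coboundary of \<open>x\<close> has the coefficient \<open>- Db\<close> there.\<close>
      define g where "g = f + smult [:- (- cf f 0 2 / Db):] W"
      have "cocycle Db Dl (EV g)" "homogeneous n g"
        unfolding g_def by (intro cocycle_comb homogeneous_comb cocycle homogeneous W)+
      moreover have "cf W 0 2 = - Db"
        using cf_cob_monom(1)[OF n(1)] \<open>n = 1\<close> by (simp add: W_def)
      then have "cf g (n - 1) 2 = 0" using \<open>n = 1\<close> \<open>Db \<noteq> 0\<close> by (simp add: g_def)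
      ultimately have "g = 0" by (rule homogeneous_zero) (use \<open>n = 1\<close> in simp)
      then show ?thesis unfolding g_def by (blast dest: smult_cancel)
    qed
    then show ?thesis unfolding W_def using True by auto
  qed
qed

section \<open>The action of N\<close>

text \<open>No coboundaries are divided out here, because \<open>N\<close> acts by 0 on both
  modules. For nonzero \<open>Db\<close> and \<open>Db + n\<close> the solutions of degree
  \<open>n\<close> are the multiples of this form.\<close>

definition kform :: "complex \<Rightarrow> nat \<Rightarrow> bipoly" where
  "kform Db n =
    (if n = 0 then mono2 1 0 0
     else if n = 1 then mono2 1 0 1
     else if n = 2 then mono2 1 1 1 + mono2 (- Db) 0 2
     else if n = 3 \<and> Db = -2 then mono2 1 2 1 + mono2 3 1 2 + mono2 2 0 3
     else 0)"

lemma current_cocycle_0: "current_cocycle Db Db (\<lambda>x l. 1)"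
  unfolding current_cocycle_def by algebra
lemma current_cocycle_1: "current_cocycle Db (Db + 1) (\<lambda>x l. l)"
  unfolding current_cocycle_def by algebra
lemma current_cocycle_2: "current_cocycle Db (Db + 2) (\<lambda>x l. x * l - Db * l ^ 2)"
  unfolding current_cocycle_def by algebra
lemma current_cocycle_3: "current_cocycle (-2) 1 (\<lambda>x l. x ^ 2 * l + 3 * x * l ^ 2 + 2 * l ^ 3)"
  unfolding current_cocycle_def by algebra

lemma current_cocycle_kform: "current_cocycle Db (Db + of_nat n) (EV (kform Db n))"
proof -
  consider "n = 0" | "n = 1" | "n = 2" | "n = 3" "Db = -2" | "kform Db n = 0"
    unfolding kform_def by argo
  then show ?thesis
  proof cases
    case 1
    then have "EV (kform Db n) = (\<lambda>x l. 1)" by (intro ext) (simp add: kform_def)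
    then show ?thesis using current_cocycle_0 1 by simp
  next
    case 2
    then have "EV (kform Db n) = (\<lambda>x l. l)" by (intro ext) (simp add: kform_def)
    then show ?thesis using current_cocycle_1 2 by simp
  next
    case 3
    then have "EV (kform Db n) = (\<lambda>x l. x * l - Db * l ^ 2)" by (intro ext) (simp add: kform_def)
    then show ?thesis using current_cocycle_2 3 by simp
  next
    case 4
    then have "EV (kform Db n) = (\<lambda>x l. x ^ 2 * l + 3 * x * l ^ 2 + 2 * l ^ 3)"
      by (intro ext) (simp add: kform_def)
    then show ?thesis using current_cocycle_3 4 by simp
  qed (simp add: current_cocycle_def)
qed

lemma current_cocycle_comb:
  assumes "current_cocycle Db Dl (EV f)" "current_cocycle Db Dl (EV g)"
  shows "current_cocycle Db Dl (EV (f + smult [:c:] g))"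
proof -
  define D where "D K x l m = ((x + Db * l) * K (x + l) m - (x + m + Dl * l) * K x m) - - m * K x (l + m)"
    for K and x l m :: complex
  have "D (EV (f + smult [:c:] g)) x l m = D (EV f) x l m + c * D (EV g) x l m" for x l m
    by (simp add: D_def algebra_simps)
  moreover have "current_cocycle Db Dl F \<longleftrightarrow> (\<forall>x l m. D F x l m = 0)" for F
    by (simp only: current_cocycle_def D_def right_minus_eq)
  ultimately show ?thesis
    using assms by simp
qed

lemma current_cocycle_coefs:
  assumes "current_cocycle Db Dl (EV f)"
  shows "(if p = 0 then 0 else of_nat ((p - 1 + q) choose q) * cf f (p - 1 + q) r)
   + Db * (if q = 0 then 0 else of_nat ((p + (q - 1)) choose (q - 1)) * cf f (p + (q - 1)) r)
   - ((if p = 0 then 0 else if q = 0 then cf f (p - 1) r else 0)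
      + (if r = 0 then 0 else if q = 0 then cf f p (r - 1) else 0)
      + Dl * (if q = 0 then 0 else if q - 1 = 0 then cf f p r else 0))
   + (if r = 0 then 0 else of_nat ((q + (r - 1)) choose (r - 1)) * cf f p (q + (r - 1))) = 0"
proof -
  have 0: "has_coefs (\<lambda>x l m. EV f x m) (\<lambda>p q r. if q = 0 then cf f p r else 0)"
    by (rule has_coefs_swap[OF has_coefs_EV])
  note 1 = has_coefs_add[OF has_coefs_diff[OF
      has_coefs_add[OF has_coefs_x[OF has_coefs_EV_shift[of f]]
        has_coefs_scale[OF has_coefs_l[OF has_coefs_EV_shift[of f]], of Db]]
      has_coefs_add[OF has_coefs_add[OF has_coefs_x[OF 0] has_coefs_m[OF 0]]
        has_coefs_scale[OF has_coefs_l[OF 0], of Dl]]]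
      has_coefs_m[OF has_coefs_EV_sum[of f]]]
  have "(x * EV f (x + l) m + Db * (l * EV f (x + l) m))
      - (x * EV f x m + m * EV f x m + Dl * (l * EV f x m)) + m * EV f x (l + m) = 0" for x l m
    using assms[unfolded current_cocycle_def, rule_format, of x l m] by algebra
  from has_coefs_zero[OF 1[unfolded this]] show ?thesis .
qed

context
  fixes Db Dl :: complex and f :: bipoly
  assumes current_cocycle: "current_cocycle Db Dl (EV f)"
begin

text \<open>The coefficient of \<open>l\<close> is an Euler equation without a further term, so a
  solution is homogeneous of degree \<open>Dl - Db\<close>.\<close>

lemma current_cocycle_cf_1: "(of_nat (p + r) - (Dl - Db)) * cf f p r = 0"
  using current_cocycle_coefs[OF current_cocycle, of p 1 r] by (cases p; cases r) (simp_all add: algebra_simps)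

lemma current_cocycle_cf_0:
  assumes "Db \<noteq> 0" "i \<ge> 1"
  shows "cf f i 0 = 0"
  using current_cocycle_coefs[OF current_cocycle, of 0 "i + 1" 0] assms by simp

lemma current_cocycle_cf_ge_2:
  assumes "q \<ge> 2" "r \<ge> 1"
  shows "ecf Db p q * cf f (p + q - 1) r
    + of_nat ((q + r - 1) choose (r - 1)) * cf f p (q + r - 1) = 0"
  using current_cocycle_coefs[OF current_cocycle, of p q r] assms
  by (cases p; cases q; cases r) (simp_all add: ecf_def algebra_simps binomial_eq_0)

end

text \<open>The relation with \<open>q = 2\<close> leads from \<open>l^r\<close> to
  \<open>l^(r + 1)\<close> with a nonzero binomial factor, so the coefficient at \<open>l\<close>
  determines the solution.\<close>

lemma current_cocycle_zero:
  assumes current_cocycle: "current_cocycle Db (Db + of_nat n) (EV f)" and "Db \<noteq> 0" "n \<ge> 1" "cf f (n - 1) 1 = 0"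
  shows "f = 0"
proof -
  have *: "cf f (n - r) r = 0" if "r \<le> n" for r
    using that
  proof (induction r)
    case 0
    then show ?case using current_cocycle_cf_0[OF current_cocycle] assms by simp
  next
    case (Suc r)
    show ?case
    proof (cases "r = 0")
      case False
      define p where "p = n - Suc r"
      have p: "n - r = p + 1" "n - Suc r = p" using Suc.prems by (auto simp: p_def)
      have "of_nat ((2 + r - 1) choose (r - 1)) * cf f p (2 + r - 1) = 0"
        using current_cocycle_cf_ge_2[OF current_cocycle, of 2 r p] False Suc.IH Suc.prems p by simp
      moreover have "of_nat ((2 + r - 1) choose (r - 1)) \<noteq> (0::complex)" by simp
      ultimately show ?thesis using p by simp
    qed (use assms in simp)
  qed
  have "cf f p q = 0" for p q
  proof (cases "p + q = n")
    case True
    then show ?thesis using *[of q] by auto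
  next
    case False
    then have "of_nat (p + q) \<noteq> (of_nat n :: complex)" using of_nat_eq_iff by blast
    then show ?thesis using current_cocycle_cf_1[OF current_cocycle, of p q] by simp
  qed
  then show ?thesis by (intro cf_eqI) simp
qed

text \<open>For consecutive coefficients \<open>x\<close>, \<open>y\<close>, \<open>z\<close>, two
  relations with \<open>q = 2\<close> and one with \<open>q = 3\<close> give \<open>z\<close> in
  terms of \<open>x\<close> in two ways. The condition on \<open>d\<close> says
  \<open>d = 2 * a * b / (3 * c)\<close>, the factor left after \<open>m * m' * x\<close> is
  cancelled.\<close>

lemma k_relation:
  fixes m A x a y m' B b z C c d :: complex
  assumes "m * A / 2 * x + a * y = 0" "m' * B / 2 * y + b * z = 0" "m * m' * C / 6 * x + c * z = 0"
    and "3 * c * d = 2 * a * b" "c \<noteq> 0" "m \<noteq> 0" "m' \<noteq> 0" "x \<noteq> 0"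
  shows "B * A + d * C = 0"
proof -
  have e: "m * A * x = - 2 * a * y" "m' * B * y = - 2 * b * z" "m * m' * C * x = - 6 * c * z"
    using assms(1-3) by algebra+
  have "m * m' * x * (3 * c * (B * A + d * C))
      = 3 * c * (m' * B) * (m * A * x) + (3 * c * d) * (m * m' * C * x)"
    by algebra
  also have "\<dots> = - 6 * a * c * (m' * B * y) + 2 * a * b * (- 6 * c * z)"
    unfolding e(1,3) assms(4) by algebra
  also have "\<dots> = 0"
    unfolding e(2) by algebra
  finally have "m * m' * x * (3 * c * (B * A + d * C)) = 0" .
  then show ?thesis using assms(5-) by simp
qed

lemma k_classification:
  assumes current_cocycle: "current_cocycle Db Dl (EV f)" and nz: "Db \<noteq> 0" "Dl \<noteq> 0" and "f \<noteq> 0"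
  shows "\<exists>n c. Dl = Db + of_nat n \<and> f = smult [:c:] (kform Db n)"
proof -
  obtain p q where "cf f p q \<noteq> 0" using \<open>f \<noteq> 0\<close> cf_eqI[of f 0] by auto
  define n where "n = p + q"
  define N :: complex where "N = of_nat n"
  have n: "Dl = Db + of_nat n"
    using current_cocycle_cf_1[OF current_cocycle, of p q] \<open>cf f p q \<noteq> 0\<close> by (simp add: n_def)
  note current_cocycle = current_cocycle[unfolded n]
  have k_normal_form: "\<exists>c. f = smult [:c:] (kform Db n)" if "n \<ge> 1" "cf (kform Db n) (n - 1) 1 = 1"
  proof -
    define g where "g = f + smult [:- cf f (n - 1) 1:] (kform Db n)"
    have "current_cocycle Db (Db + of_nat n) (EV g)"
      unfolding g_def by (intro current_cocycle_comb current_cocycle current_cocycle_kform)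
    moreover have "cf g (n - 1) 1 = 0" by (simp add: g_def that(2)[simplified])
    ultimately have "g = 0" using current_cocycle_zero nz(1) that(1) by blast
    then show ?thesis unfolding g_def by (blast dest: smult_cancel)
  qed
  show ?thesis
  proof (cases "n \<le> 2 \<or> n = 3 \<and> Db = -2")
    case True
    then consider "n = 0" | "n = 1" | "n = 2" | "n = 3" "Db = -2" by linarith
    then show ?thesis
    proof cases
      case 1
      have "f = smult [:cf f 0 0:] (kform Db n)"
      proof (rule cf_eqI)
        fix p q
        have "of_nat (p + q) \<noteq> (0 :: complex)" if "\<not> (p = 0 \<and> q = 0)"
          using that by (metis add_is_0 of_nat_eq_0_iff)
        then show "cf f p q = cf (smult [:cf f 0 0:] (kform Db n)) p q"
          using current_cocycle_cf_1[OF current_cocycle, of p q] 1 by (auto simp: kform_def)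
      qed
      then show ?thesis using n by blast
    next
      case 2
      then have "cf (kform Db n) (n - 1) 1 = 1" by (simp add: kform_def)
      moreover have "n \<ge> 1" using 2 by simp
      ultimately show ?thesis using k_normal_form n by blast
    next
      case 3
      then have "cf (kform Db n) (n - 1) 1 = 1" by (simp add: kform_def)
      moreover have "n \<ge> 1" using 3 by simp
      ultimately show ?thesis using k_normal_form n by blast
    next
      case 4
      then have "cf (kform Db n) (n - 1) 1 = 1" by (simp add: kform_def)
      moreover have "n \<ge> 1" using 4 by simp
      ultimately show ?thesis using k_normal_form n by blast
    qed
  next
    case False
    then have n3: "n \<ge> 3" by simp
    define \<kappa> where "\<kappa> r = cf f (n - r) r" for r
    have k1: "\<kappa> 1 \<noteq> 0" using current_cocycle_zero[OF current_cocycle nz(1)] n3 \<open>f \<noteq> 0\<close> by (auto simp: \<kappa>_def)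
    have eq: "x * \<kappa> r + c * \<kappa> k = 0"
      if "q \<ge> 2" "r \<ge> 1" "k = q + r - 1" "k \<le> n" "of_nat (k choose (r - 1)) = c"
        "of_nat ((n - r) choose q) + Db * of_nat ((n - r) choose (q - 1)) = x" for q r k x c
    proof -
      have "n - k + q - 1 = n - r" using that by auto
      then show ?thesis
        using current_cocycle_cf_ge_2[OF current_cocycle, of q r "n - k"] that by (simp add: \<kappa>_def ecf_def)
    qed
    have M: "of_nat (n - 1) = N - 1" "of_nat (n - 2) = N - 2" "of_nat (n - 3) = N - 3"
      using n3 by (simp_all add: N_def of_nat_diff)
    have ne: "N - 1 \<noteq> 0" "N - 2 \<noteq> 0" "N \<noteq> 0"
      unfolding N_def using n3 of_nat_eq_iff[of n 1, where ?'a = complex] of_nat_eq_iff[of n 2, where ?'a = complex]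
      by auto
    have 1: "(N - 1) * (N - 1 - 1 + 2 * Db) / 2 * \<kappa> 1 + 1 * \<kappa> 2 = 0"
      by (rule eq[OF _ _ _ _ _ ecf_numeral(1)]) (use n3 M in \<open>simp_all add: numeral_eq_Suc\<close>)
    have 2: "(N - 2) * (N - 2 - 1 + 2 * Db) / 2 * \<kappa> 2 + 3 * \<kappa> 3 = 0"
      by (rule eq[OF _ _ _ _ _ ecf_numeral(1)]) (use n3 M in \<open>simp_all add: numeral_eq_Suc\<close>)
    have 3: "(N - 1) * (N - 1 - 1) * (N - 1 - 2 + 3 * Db) / 6 * \<kappa> 1 + 1 * \<kappa> 3 = 0"
      by (rule eq[OF _ _ _ _ _ ecf_numeral(2)]) (use n3 M in \<open>simp_all add: numeral_eq_Suc\<close>)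
    \<comment> \<open>Compatibility of the two ways from \<open>\<kappa> 1\<close> to
      \<open>\<kappa> 3\<close>, directly and through \<open>\<kappa> 2\<close>.\<close>
    have Q1: "(N - 3 + 2 * Db) * (N - 2 + 2 * Db) + 2 * (N - 3) + 6 * Db = 0"
    proof -
      have "(N - 1) * (N - 2 + 2 * Db) / 2 * \<kappa> 1 + \<kappa> 2 = 0"
        "(N - 2) * (N - 3 + 2 * Db) / 2 * \<kappa> 2 + 3 * \<kappa> 3 = 0"
        "(N - 1) * (N - 2) * (N - 3 + 3 * Db) / 6 * \<kappa> 1 + \<kappa> 3 = 0"
        using 1 2 3 by simp_all
      then have "(N - 3 + 2 * Db) * (N - 2 + 2 * Db) + 2 * (N - 3 + 3 * Db) = 0"
        by (intro k_relation[of "N - 1" "N - 2 + 2 * Db" "\<kappa> 1" 1 "\<kappa> 2" "N - 2" "N - 3 + 2 * Db" 3 "\<kappa> 3"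
              "N - 3 + 3 * Db" 1 2]) (use ne k1 in simp_all)
      then show ?thesis by (simp add: algebra_simps)
    qed
    show ?thesis
    proof (cases "n = 3")
      case True
      then have "N = 3" by (simp add: N_def)
      then have "4 * (Db * (Db + 2)) = 0" using Q1 by (simp add: algebra_simps)
      then have "Db = -2" using nz by (simp add: eq_neg_iff_add_eq_0)
      then show ?thesis using False True by simp
    next
      case n4: False
      then have ne3: "N - 3 \<noteq> 0"
        using of_nat_eq_iff[of n 3, where ?'a = complex] by (simp add: N_def)
      \<comment> \<open>If \<open>\<kappa> 2\<close> were 0, the first relation would give
        \<open>2 * Db = 2 - N\<close>, and \<open>Q1\<close> would then give
        \<open>N = 0\<close>.\<close>
      have k2: "\<kappa> 2 \<noteq> 0"
      proof
        assume "\<kappa> 2 = 0"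
        then have "N - 1 - 1 + 2 * Db = 0" using 1 ne k1 by simp
        with Q1 have "N = 0" by algebra
        then show False using ne by simp
      qed
      have 4: "(N - 3) * (N - 3 - 1 + 2 * Db) / 2 * \<kappa> 3 + 6 * \<kappa> 4 = 0"
        by (rule eq[OF _ _ _ _ _ ecf_numeral(1)]) (use n3 n4 M in \<open>simp_all add: numeral_eq_Suc\<close>)
      have 5: "(N - 2) * (N - 2 - 1) * (N - 2 - 2 + 3 * Db) / 6 * \<kappa> 2 + 4 * \<kappa> 4 = 0"
        by (rule eq[OF _ _ _ _ _ ecf_numeral(2)]) (use n3 n4 M in \<open>simp_all add: numeral_eq_Suc\<close>)
      \<comment> \<open>The same compatibility one step further, from \<open>\<kappa> 2\<close> to
        \<open>\<kappa> 4\<close>.\<close>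
      have "(N - 4 + 2 * Db) * (N - 3 + 2 * Db) + 3 * (N - 4) + 9 * Db = 0"
      proof -
        have "(N - 2) * (N - 3 + 2 * Db) / 2 * \<kappa> 2 + 3 * \<kappa> 3 = 0"
          "(N - 3) * (N - 4 + 2 * Db) / 2 * \<kappa> 3 + 6 * \<kappa> 4 = 0"
          "(N - 2) * (N - 3) * (N - 4 + 3 * Db) / 6 * \<kappa> 2 + 4 * \<kappa> 4 = 0"
          using 2 4 5 by simp_all
        then have "(N - 4 + 2 * Db) * (N - 3 + 2 * Db) + 3 * (N - 4 + 3 * Db) = 0"
          by (intro k_relation[of "N - 2" "N - 3 + 2 * Db" "\<kappa> 2" 3 "\<kappa> 3" "N - 3" "N - 4 + 2 * Db" 6 "\<kappa> 4"
                "N - 4 + 3 * Db" 4 3]) (use ne ne3 k2 in simp_all)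
        then show ?thesis by (simp add: algebra_simps)
      qed
      \<comment> \<open>The difference of the two quadratic relations is \<open>Db + N\<close>, that
        is, the nonzero \<open>Dl\<close>.\<close>
      with Q1 have "Db + N = 0" by algebra
      then show ?thesis using n nz by (simp add: N_def)
    qed
  qed
qed

section \<open>Extensions\<close>

text \<open>Passage to the variable \<open>x = \<partial> + \<alpha>\<close>, which removes
  \<open>\<alpha>\<close> from the equations.\<close>

definition translate :: "complex \<Rightarrow> bipoly \<Rightarrow> bipoly" where
  "translate al f = map_poly (\<lambda>p. pcompose p [:- al, 1:]) f"

lemma EV_translate [simp]: "EV (translate al f) x l = EV f (x - al) l"
  unfolding translate_def by (induction f) (simp_all add: map_poly_pCons poly_pcompose)

lemma translate_eq_iff:
  assumes "\<And>x l. EV X x l = EV R (x + al) l"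
  shows "f = X \<longleftrightarrow> translate al f = R"
proof
  show "translate al f = R" if "f = X" using that assms by (intro EV_eqI) simp
next
  assume *: "translate al f = R"
  show "f = X"
  proof (rule EV_eqI)
    fix x l
    have "EV (translate al f) (x + al) l = EV R (x + al) l" using * by simp
    then show "EV f x l = EV X x l" using assms by simp
  qed
qed

lemma translate_eq_0_iff: "translate al f = 0 \<longleftrightarrow> f = 0"
  by (rule translate_eq_iff[symmetric]) simp

lemma translate_surj: "translate al (translate (- al) R) = R"
  by (rule EV_eqI) simp

lemma poly_ev [simp]: "poly (ev f l) x = EV f x l"
  by (simp add: ev_def EV_def)

lemma poly_shift [simp]: "poly (shift p l) x = poly p (l + x)"
  by (simp add: shift_def poly_pcompose)

lemma poly_base [simp]: "poly (base al D a l) x = (if a = L then x + al + D * l else 0)"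
  by (simp add: base_def)

lemma poly_eqI_complex: "(\<And>x :: complex. poly p x = poly q x) \<Longrightarrow> p = q"
  using poly_eq_poly_eq_iff by blast

section \<open>Module axioms and equivalences as polynomial identities\<close>

definition bracket_at :: "complex \<Rightarrow> complex \<Rightarrow> complex \<Rightarrow> bipoly \<Rightarrow> bipoly \<Rightarrow> bipoly \<Rightarrow> bipoly \<Rightarrow>
    gen \<Rightarrow> gen \<Rightarrow> complex \<Rightarrow> complex \<Rightarrow> elt \<Rightarrow> bool" where
  "bracket_at al Db Dl f g h k a b l m x \<longleftrightarrow>
    (let A = act al Db Dl f g h k in
      esub (A a l (A b m x)) (A b m (A a l x)) =
        foldr eadd (map (\<lambda>c. esc [:sv_br a b c (- (l + m)) l:] (A c (l + m) x)) [L, M, Y, N])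
          (0, 0))"

text \<open>Additivity, scalar linearity and sesquilinearity are built into \<open>act\<close>, so
  only the bracket axiom is a condition.\<close>

lemma is_ext_bracket:
  "is_ext al Db Dl f g h k \<longleftrightarrow> (\<forall>a b l m x. bracket_at al Db Dl f g h k a b l m x)"
proof -
  let ?A = "act al Db Dl f g h k"
  have "?A a l (eadd x y) = eadd (?A a l x) (?A a l y)" for a l x y
    by (simp add: act_def eadd_def shift_def pcompose_add algebra_simps)
  moreover have "?A a l (esc [:c:] x) = esc [:c:] (?A a l x)" for a l c x
    by (simp add: act_def esc_def shift_def pcompose_smult algebra_simps)
  moreover have "?A a l (esc [:0, 1:] x) = esc [:l, 1:] (?A a l x)" for a l x
    by (auto simp: act_def esc_def algebra_simps intro!: poly_eqI_complex)
  ultimately show ?thesis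
    unfolding is_ext_def is_conf_mod_def bracket_at_def Let_def by blast
qed

lemma bracket_at_poly:
  "bracket_at al Db Dl f g h k a b l m (p, q) \<longleftrightarrow> (\<forall>t.
    (let D = (\<lambda>D a l t. if a = L then t + al + D * l else 0);
         F = (\<lambda>a l t. EV (Fof f g h k a) t l);
         S = (\<lambda>u. \<Sum>c\<leftarrow>[L, M, Y, N]. sv_br a b c (- (l + m)) l * u c) in
     ((poly p (m + (l + t)) * D Db b m (l + t) + poly q (m + (l + t)) * F b m (l + t)) * D Db a l t
        + poly q (m + (l + t)) * D Dl b m (l + t) * F a l t)
     - ((poly p (m + (l + t)) * D Db a l (m + t) + poly q (m + (l + t)) * F a l (m + t)) * D Db b m t
        + poly q (m + (l + t)) * D Dl a l (m + t) * F b m t)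
     = S (\<lambda>c. poly p (m + (l + t)) * D Db c (l + m) t + poly q (m + (l + t)) * F c (l + m) t)
    \<and> poly q (m + (l + t)) * D Dl b m (l + t) * D Dl a l t
      - poly q (m + (l + t)) * D Dl a l (m + t) * D Dl b m t
     = S (\<lambda>c. poly q (m + (l + t)) * D Dl c (l + m) t)))"
proof -
  have s: "l + (m + t) = m + (l + t)" "l + m + t = m + (l + t)" for t by simp_all
  show ?thesis
    unfolding bracket_at_def Let_def prod_eq_iff poly_eq_poly_eq_iff[symmetric] fun_eq_iff all_conj_distrib
    by (simp add: act_def esub_def eadd_def esc_def s del: add.assoc)
qed


text \<open>\<open>M\<close>, \<open>Y\<close> and \<open>N\<close> map the generator into the
  submodule and act by 0 there, so their commutators vanish on it, while \<open>(N, M)\<close> must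
  give \<open>2 * g\<close> and \<open>(N, Y)\<close> must give \<open>h\<close>. The pairs
  \<open>(L, L)\<close> and \<open>(L, N)\<close> yield the two cocycle equations.\<close>

lemma is_ext_iff:
  "is_ext al Db Dl f g h k \<longleftrightarrow>
    g = 0 \<and> h = 0 \<and> cocycle Db Dl (EV (translate al f)) \<and> current_cocycle Db Dl (EV (translate al k))"
proof
  assume "is_ext al Db Dl f g h k"
  then have B: "bracket_at al Db Dl f g h k a b l m (0, 1)" for a b and l m :: complex
    by (simp add: is_ext_bracket)
  have "EV g t l = 0" for t l
    using bracket_at_poly[THEN iffD1, OF B, of N M 0 l, unfolded Let_def, THEN spec, THEN conjunct1, of t]
    by (simp add: sv_br_def is_given_def Fof_def)
  moreover have "EV h t l = 0" for t l
    using bracket_at_poly[THEN iffD1, OF B, of N Y 0 l, unfolded Let_def, THEN spec, THEN conjunct1, of t]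
    by (simp add: sv_br_def is_given_def Fof_def)
  moreover have "cocycle Db Dl (EV (translate al f))"
    unfolding cocycle_def
  proof (intro allI)
    fix x l m
    have s: "l + (x - al) = x + l - al" "m + (x - al) = x + m - al" "x - al + al = x"
      "x + l - al + al = x + l" "x + m - al + al = x + m" by simp_all
    show "(x + l + Dl * m) * EV (translate al f) x l + (x + Db * l) * EV (translate al f) (x + l) m -
        ((x + m + Dl * l) * EV (translate al f) x m + (x + Db * m) * EV (translate al f) (x + m) l) =
        (l - m) * EV (translate al f) x (l + m)"
      using bracket_at_poly[THEN iffD1, OF B, of L L l m, unfolded Let_def, THEN spec, THEN conjunct1, of "x - al"]
      by (simp add: sv_br_def is_given_def Fof_def s) algebra
  qed
  moreover have "current_cocycle Db Dl (EV (translate al k))"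
    unfolding current_cocycle_def
  proof (intro allI)
    fix x l m
    have s: "l + (x - al) = x + l - al" "m + (x - al) = x + m - al" "x - al + al = x"
      "x + l - al + al = x + l" "x + m - al + al = x + m" by simp_all
    show "(x + Db * l) * EV (translate al k) (x + l) m - (x + m + Dl * l) * EV (translate al k) x m
        = - m * EV (translate al k) x (l + m)"
      using bracket_at_poly[THEN iffD1, OF B, of L N l m, unfolded Let_def, THEN spec, THEN conjunct1, of "x - al"]
      by (simp add: sv_br_def is_given_def Fof_def s) algebra
  qed
  ultimately show "g = 0 \<and> h = 0 \<and> cocycle Db Dl (EV (translate al f)) \<and> current_cocycle Db Dl (EV (translate al k))"
    using EV_eq_0 by blast
next
  assume A: "g = 0 \<and> h = 0 \<and> cocycle Db Dl (EV (translate al f)) \<and> current_cocycle Db Dl (EV (translate al k))"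
  have s: "t + al + l - al = l + t" "t + al - al = t" for t l :: complex by simp_all
  have LL: "(t + al + l + Dl * m) * EV f t l + (t + al + Db * l) * EV f (l + t) m -
        ((t + al + m + Dl * l) * EV f t m + (t + al + Db * m) * EV f (m + t) l) =
        (l - m) * EV f t (l + m)" for t l m
    using A[THEN conjunct2, THEN conjunct2, THEN conjunct1, unfolded cocycle_def, rule_format, of "t + al" l m]
    by (simp add: s)
  have LN: "(t + al + Db * l) * EV k (l + t) m - (t + al + m + Dl * l) * EV k t m
        = - m * EV k t (l + m)" for t l m
    using A[THEN conjunct2, THEN conjunct2, THEN conjunct2, unfolded current_cocycle_def, rule_format, of "t + al" l m]
    by (simp add: s)
  have gh: "g = 0" "h = 0" using A by auto
  have "bracket_at al Db Dl f g h k a b l m (p, q)" for a b l m p q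
    unfolding bracket_at_poly Let_def
  proof (intro allI, goal_cases)
    case (1 t)
    \<comment> \<open>The pair \<open>(N, L)\<close> is the \<open>(L, N)\<close> equation with
      \<open>l\<close> and \<open>m\<close> exchanged; the remaining pairs are trivial once
      \<open>g = h = 0\<close>.\<close>
    show ?case
      using LL[of t l m] LN[of t l m] LN[of t m l, unfolded add.commute[of m l]]
      by (induct a; induct b)
        (simp_all add: sv_br_def is_given_def Fof_def gh, intro conjI, algebra+)
  qed
  then show "is_ext al Db Dl f g h k"
    unfolding is_ext_bracket by (metis surj_pair)
qed


text \<open>By linearity an equivalence is determined by the image of the generator
  \<open>(0, 1)\<close>, and all equations are its compatibility with the action on this one
  element.\<close>

lemma ext_equivD:
  assumes "ext_equiv al Db Dl (f, g, h, k) (f', g', h', k')"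
  shows "g = g' \<and> h = h' \<and> k = k' \<and> (\<exists>\<phi>. translate al f' = translate al f + cob Db Dl \<phi>)"
proof -
  obtain \<Phi> where add: "\<And>x y. \<Phi> (eadd x y) = eadd (\<Phi> x) (\<Phi> y)"
    and smult: "\<And>s x. \<Phi> (esc s x) = esc s (\<Phi> x)"
    and fst: "\<And>p. \<Phi> (p, 0) = (p, 0)" and snd: "\<And>x. snd (\<Phi> x) = snd x"
    and act: "\<And>a l x. \<Phi> (act al Db Dl f g h k a l x) = act al Db Dl f' g' h' k' a l (\<Phi> x)"
    using assms unfolding ext_equiv_def prod.case by blast
  define \<phi> where "\<phi> = fst (\<Phi> (0, 1))"
  have 1: "\<Phi> (0, 1) = (\<phi>, 1)"
    using snd[of "(0, 1)"] by (simp add: \<phi>_def prod_eq_iff)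
  have \<Phi>: "\<Phi> (p, q) = (p + q * \<phi>, q)" for p q
    using add[of "(p, 0)" "esc q (0, 1)"] by (simp add: smult fst 1) (simp add: eadd_def esc_def)
  have "ev (Fof f g h k a) l + base al Dl a l * \<phi> = shift \<phi> l * base al Db a l + ev (Fof f' g' h' k' a) l"
    for a l
    using act[of a l "(0, 1)"] by (simp add: act_def 1 \<Phi> shift_def pcompose_1)
  from arg_cong[OF this, of poly, THEN fun_cong]
  have E: "EV (Fof f g h k a) t l + (if a = L then t + al + Dl * l else 0) * poly \<phi> t =
      poly \<phi> (l + t) * (if a = L then t + al + Db * l else 0) + EV (Fof f' g' h' k' a) t l" for a t l
    by simp
  have "g = g'" "h = h'" "k = k'"
    using E[of M] E[of Y] E[of N] by (auto simp: Fof_def intro!: EV_eqI)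
  moreover have "translate al f' = translate al f + cob Db Dl (pcompose \<phi> [:- al, 1:])"
  proof (rule EV_eqI)
    fix x l
    show "EV (translate al f') x l = EV (translate al f + cob Db Dl (pcompose \<phi> [:- al, 1:])) x l"
      using E[of L "x - al" l] by (simp add: Fof_def poly_pcompose algebra_simps)
  qed
  ultimately show ?thesis by blast
qed

lemma ext_equivI:
  assumes "translate al f' = translate al f + cob Db Dl \<phi>"
  shows "ext_equiv al Db Dl (f, g, h, k) (f', g, h, k)"
proof -
  define \<psi> where "\<psi> = pcompose \<phi> [:al, 1:]"
  define \<Phi> where "\<Phi> x = (fst x + snd x * \<psi>, snd x)" for x :: elt
  have E: "EV f' t l + poly \<psi> (l + t) * (t + al + Db * l) = EV f t l + (t + al + Dl * l) * poly \<psi> t" for t l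
    using arg_cong[OF assms, of "\<lambda>f. EV f (t + al) l"]
    by (simp add: \<psi>_def poly_pcompose algebra_simps)
  have "\<Phi> (act al Db Dl f g h k a l x) = act al Db Dl f' g h k a l (\<Phi> x)" for a l x
  proof (rule prod_eqI)
    show "fst (\<Phi> (act al Db Dl f g h k a l x)) = fst (act al Db Dl f' g h k a l (\<Phi> x))"
    proof (rule poly_eqI_complex)
      fix t
      show "poly (fst (\<Phi> (act al Db Dl f g h k a l x))) t = poly (fst (act al Db Dl f' g h k a l (\<Phi> x))) t"
        using E[of t l] by (induct a) (simp_all add: \<Phi>_def act_def Fof_def, algebra+)
    qed
  qed (simp add: \<Phi>_def act_def)
  moreover have "\<Phi> (eadd x y) = eadd (\<Phi> x) (\<Phi> y)" "\<Phi> (esc s x) = esc s (\<Phi> x)"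
    "\<Phi> (p, 0) = (p, 0)" "snd (\<Phi> x) = snd x" for x y s p
    by (simp_all add: \<Phi>_def eadd_def esc_def algebra_simps)
  ultimately show ?thesis
    unfolding ext_equiv_def prod.case by blast
qed

section \<open>Normal forms of \<open>f\<close> modulo coboundaries\<close>

definition f_normal_form :: "complex \<Rightarrow> nat \<Rightarrow> bipoly \<Rightarrow> bool" where
  "f_normal_form Db n R \<longleftrightarrow> n = 0 \<and> (\<exists>c0 c1. R = mono2 c0 0 0 + mono2 c1 0 1)
      \<or> n \<ge> 1 \<and> (\<exists>c. R = smult [:c:] (fform Db n))"

lemma f_normal_form_0: "f_normal_form Db n 0"
proof (cases "n = 0")
  case True
  have "(0 :: bipoly) = mono2 0 0 0 + mono2 0 0 1" by (simp add: mono2_def)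
  then show ?thesis using True unfolding f_normal_form_def by blast
next
  case False
  have "(0 :: bipoly) = smult [:0:] (fform Db n)" by simp
  then show ?thesis using False unfolding f_normal_form_def by (metis One_nat_def Suc_leI neq0_conv)
qed

lemma cocycle_smult: "cocycle Db Dl (EV f) \<Longrightarrow> cocycle Db Dl (EV (smult [:c:] f))"
  using cocycle_comb[of Db Dl 0 f c] by (simp add: cocycle_def)

lemma cocycle_linear: "cocycle Db Db (\<lambda>x l. c0 + c1 * l)"
  unfolding cocycle_def by algebra

lemma cocycle_f_normal_form:
  assumes "f_normal_form Db n R" "Dl = Db + of_nat n"
  shows "cocycle Db Dl (EV R)"
  using assms(1) unfolding f_normal_form_def
proof
  assume *: "n = 0 \<and> (\<exists>c0 c1. R = mono2 c0 0 0 + mono2 c1 0 1)"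
  then obtain c0 c1 where "R = mono2 c0 0 0 + mono2 c1 0 1" by blast
  then have "EV R = (\<lambda>x l. c0 + c1 * l)" by (intro ext) simp
  moreover have "Dl = Db" using * assms(2) by simp
  ultimately show ?thesis using cocycle_linear by simp
qed (use assms(2) cocycle_smult cocycle_fform in auto)

text \<open>For \<open>n = 0\<close> both terms of a coboundary vanish on the line
  \<open>x = - Db * l\<close>. For \<open>n \<ge> 1\<close> its coefficients at \<open>l^2\<close>
  and \<open>l^3\<close> in degree \<open>n + 1\<close> are proportional to those of the coboundary
  of \<open>x^n\<close>, and \<open>cob_fform_det\<close> applies.\<close>

lemma f_normal_form_cob:
  assumes "f_normal_form Db n (cob Db Dl \<phi>)" "Dl = Db + of_nat n" "Db \<noteq> 0"
  shows "cob Db Dl \<phi> = 0"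
  using assms(1) unfolding f_normal_form_def
proof
  assume *: "n = 0 \<and> (\<exists>c0 c1. cob Db Dl \<phi> = mono2 c0 0 0 + mono2 c1 0 1)"
  then obtain c0 c1 where c: "cob Db Dl \<phi> = mono2 c0 0 0 + mono2 c1 0 1" by blast
  have "c0 + c1 * l = 0" for l
    using arg_cong[OF c, of "\<lambda>f. EV f (- Db * l) l"] * assms(2) by simp
  from this[of 0] this[of 1] show ?thesis using c by (simp add: mono2_def)
next
  assume "n \<ge> 1 \<and> (\<exists>c. cob Db Dl \<phi> = smult [:c:] (fform Db n))"
  then obtain c where n: "n \<ge> 1" and c: "cob Db Dl \<phi> = smult [:c:] (fform Db n)" by blast
  show ?thesis
  proof (cases "fform Db n = 0")
    case False
    note det = cob_fform_det[OF False assms(2)]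
    define W where "W = cob Db Dl (monom 1 n)"
    have "cf (cob Db Dl \<phi>) (n - 1) 2 = coeff \<phi> n * cf W (n - 1) 2"
      "cf (cob Db Dl \<phi>) (n - 2) 3 = coeff \<phi> n * cf W (n - 2) 3"
      using det(1) by (simp_all add: cf_cob W_def)
    then have "c * (cf W (n - 1) 2 * cf (fform Db n) (n - 2) 3
        - cf W (n - 2) 3 * cf (fform Db n) (n - 1) 2) = 0"
      unfolding c cf_simps by algebra
    then have "c = 0" using det(2) unfolding W_def mult_eq_0_iff by blast
    then show ?thesis using c by simp
  qed (use c in simp)
qed

lemma cob_add: "cob Db Dl (\<phi> + \<psi>) = cob Db Dl \<phi> + cob Db Dl \<psi>"
  and cob_minus: "cob Db Dl (- \<phi>) = - cob Db Dl \<phi>"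
  by (intro EV_eqI; simp add: algebra_simps)+

lemma cob_smult: "smult [:s:] (cob Db Dl \<phi>) = cob Db Dl (smult s \<phi>)"
  by (intro EV_eqI) (simp add: algebra_simps)

lemma f_classification:
  assumes "cocycle Db Dl (EV f)" "Db \<noteq> 0"
  shows "\<exists>\<phi> R. f = cob Db Dl \<phi> + R \<and> (R = 0 \<or> (\<exists>n. Dl = Db + of_nat n \<and> f_normal_form Db n R))"
proof -
  obtain \<phi> g where g: "f = cob Db Dl \<phi> + g" "cocycle Db Dl (EV g)"
    and supp: "\<And>p q. cf g p q \<noteq> 0 \<Longrightarrow>
      Dl - Db = of_nat (p + q) - 1 \<and> (q \<ge> 2 \<or> Dl = Db) \<or> p = 0 \<and> q = 0 \<and> Dl = Db"
    using cocycle_reduce[OF assms] by metis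
  consider "g = 0" | "Dl = Db" | p q where "cf g p q \<noteq> 0" "Dl \<noteq> Db"
    using cf_eqI[of g 0] by auto
  then show ?thesis
  proof cases
    case 1
    then show ?thesis using g by blast
  next
    case 2
    \<comment> \<open>The support condition leaves total degree at most 1, and the coefficient of
      \<open>x\<close> vanishes by \<open>cocycle_cf_0\<close>.\<close>
    have "g = mono2 (cf g 0 0) 0 0 + mono2 (cf g 0 1) 0 1"
    proof (rule cf_eqI)
      fix p q
      have "cf g 1 0 = 0" using cocycle_cf_0[OF g(2) assms(2), of 1] by simp
      moreover have "cf g p q = 0" if "p + q \<ge> 2"
      proof (rule ccontr)
        assume "cf g p q \<noteq> 0"
        with supp[OF this] that 2 have "of_nat (p + q) = (of_nat 1 :: complex)" by auto
        then show False using that by (simp only: of_nat_eq_iff)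
      qed
      moreover have "p + q \<ge> 2 \<or> p = 0 \<and> q = 0 \<or> p = 0 \<and> q = 1 \<or> p = 1 \<and> q = 0" by linarith
      ultimately show "cf g p q = cf (mono2 (cf g 0 0) 0 0 + mono2 (cf g 0 1) 0 1) p q" by auto
    qed
    then have "f_normal_form Db 0 g" unfolding f_normal_form_def by blast
    then show ?thesis using g 2 by (intro exI[of _ \<phi>] exI[of _ g]) (auto intro!: exI[of _ 0])
  next
    case (3 p q)
    define n where "n = p + q - 1"
    have "q \<ge> 2" using supp[OF 3(1)] 3(2) by auto
    then have n: "Dl = Db + of_nat n" "n \<ge> 1"
      using supp[OF 3(1)] 3(2) by (auto simp: n_def of_nat_diff algebra_simps)
    have "homogeneous n g"
      unfolding homogeneous_def
    proof (intro allI impI)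
      fix p' q' assume *: "cf g p' q' \<noteq> 0"
      from supp[OF this] n 3(2) have "of_nat (p' + q') = (of_nat (n + 1) :: complex)" "q' \<ge> 2"
        by (auto simp: algebra_simps)
      then show "p' + q' = n + 1 \<and> q' \<ge> 2" by (simp only: of_nat_eq_iff)
    qed
    then obtain s c where "g = smult [:s:] (cob Db Dl (monom 1 n)) + smult [:c:] (fform Db n)"
      using homogeneous_classification[OF g(2) _ n assms(2)] by blast
    then have "f = cob Db Dl (\<phi> + smult s (monom 1 n)) + smult [:c:] (fform Db n)"
      using g(1) by (simp add: cob_add cob_smult)
    moreover have "f_normal_form Db n (smult [:c:] (fform Db n))" using n unfolding f_normal_form_def by blast
    ultimately show ?thesis using n(1) by blast
  qed
qed

section \<open>The list of the theorem in terms of normal forms\<close>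

definition k_normal_form :: "complex \<Rightarrow> nat \<Rightarrow> bipoly \<Rightarrow> bool" where
  "k_normal_form Db n K \<longleftrightarrow> (\<exists>a. K = smult [:a:] (kform Db n))"

lemma EV_defs [simp]: "EV Lam x l = l" "EV Dpa x l = x" "EV (cst c) x l = c"
  by (simp_all add: Lam_def Dpa_def cst_def)

text \<open>The two signs are the two roots of the quadratic equation that guards
  \<open>fform\<close> at \<open>n = 6\<close>.\<close>

lemma sqrt19_iff:
  "(\<exists>s \<in> {1, -1 :: complex}. Dl = 7/2 + s * complex_of_real (sqrt 19) / 2 \<and>
         Db = -5/2 + s * complex_of_real (sqrt 19) / 2)
    \<longleftrightarrow> Dl = Db + 6 \<and> (2 * Db + 5)\<^sup>2 = 19"
proof -
  have "(complex_of_real (sqrt 19))\<^sup>2 = 19"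
    by (metis of_real_numeral of_real_power real_sqrt_pow2 zero_le_numeral)
  then have "(2 * Db + 5)\<^sup>2 = 19 \<longleftrightarrow> (2 * Db + 5)\<^sup>2 = (complex_of_real (sqrt 19))\<^sup>2" by simp
  also have "\<dots> \<longleftrightarrow> 2 * Db + 5 = complex_of_real (sqrt 19) \<or> 2 * Db + 5 = - complex_of_real (sqrt 19)"
    by (rule power2_eq_iff)
  finally have 1: "(2 * Db + 5)\<^sup>2 = 19 \<longleftrightarrow> (\<exists>s \<in> {1, -1}. 2 * Db + 5 = s * complex_of_real (sqrt 19))"
    by simp
  have 2: "Dl = 7/2 + z / 2 \<and> Db = -5/2 + z / 2 \<longleftrightarrow> Dl = Db + 6 \<and> 2 * Db + 5 = z" for z
  proof
    assume "Dl = 7/2 + z / 2 \<and> Db = -5/2 + z / 2"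
    then show "Dl = Db + 6 \<and> 2 * Db + 5 = z" by simp
  next
    assume "Dl = Db + 6 \<and> 2 * Db + 5 = z"
    then have "Dl = Db + 6" "z = 2 * Db + 5" by auto
    then show "Dl = 7/2 + z / 2 \<and> Db = -5/2 + z / 2" by (simp add: field_simps)
  qed
  show ?thesis unfolding 1 2 by blast
qed

lemma listed_entries:
  fixes f :: bipoly and al Db :: complex
  defines "D \<equiv> Dpa + cst al"
  shows "f = cst c0 + cst c1 * Lam \<longleftrightarrow> translate al f = mono2 c0 0 0 + mono2 c1 0 1"
    "f = cst c \<longleftrightarrow> translate al f = smult [:c:] (kform Db 0)"
    "f = cst c * Lam \<longleftrightarrow> translate al f = smult [:c:] (kform Db 1)"
    "f = cst c * Lam^2 * (2 * D + Lam) \<longleftrightarrow> translate al f = smult [:c:] (fform Db 2)"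
    "f = cst c * Lam * (D - cst Db * Lam) \<longleftrightarrow> translate al f = smult [:c:] (kform Db 2)"
    "f = cst c * D * Lam^2 * (D + Lam) \<longleftrightarrow> translate al f = smult [:c:] (fform Db 3)"
    "f = cst c * Lam * (D^2 + 3 * D * Lam + 2 * Lam^2) \<longleftrightarrow> translate al f = smult [:c:] (kform (- 2) 3)"
    "f = cst c * Lam^2 * (4 * D^3 + 6 * D^2 * Lam - D * Lam^2 + cst Db * Lam^3)
      \<longleftrightarrow> translate al f = smult [:c:] (fform Db 4)"
    "f = cst c * (D^4 * Lam^2 - 10 * D^2 * Lam^4 - 17 * D * Lam^5 - 8 * Lam^6)
      \<longleftrightarrow> translate al f = smult [:c:] (fform (- 4) 5)"
    "(2 * Db + 5)\<^sup>2 = 19 \<Longrightarrow>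
      f = cst c * (D^4 * Lam^3 - cst (2 * Db + 3) * D^3 * Lam^4
              - cst (3 * Db) * D^2 * Lam^5 - cst (3 * Db + 1) * D * Lam^6
              - cst (Db + 9/28) * Lam^7)
      \<longleftrightarrow> translate al f = smult [:c:] (fform Db 6)"
  unfolding D_def by (rule translate_eq_iff, simp add: fform_def kform_def, (rule disjI2)?,
      (algebra | simp add: algebra_simps)?)+

lemma fform_nonzero:
  "fform Db 2 \<noteq> 0" "fform Db 3 \<noteq> 0" "fform Db 4 \<noteq> 0" "fform (- 4) 5 \<noteq> 0"
  "(2 * Db + 5)\<^sup>2 = 19 \<Longrightarrow> fform Db 6 \<noteq> 0"
  \<comment> \<open>Each form has exactly one of these five coefficients nonzero, so their sum
    detects all of them.\<close>
  by - (rule notI, drule arg_cong[of _ _ "\<lambda>f. cf f 1 2 + cf f 1 3 + cf f 3 2 + cf f 4 2 + cf f 4 3"],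
      simp add: fform_def)+

lemma kform_nonzero:
  "kform Db 0 \<noteq> 0" "kform Db (Suc 0) \<noteq> 0" "kform Db 2 \<noteq> 0" "kform (- 2) 3 \<noteq> 0"
  by - (rule notI, drule arg_cong[of _ _ "\<lambda>f. cf f 0 0 + cf f 0 1 + cf f 1 1 + cf f 2 1"],
      simp add: kform_def)+

lemma form_zero:
  "fform Db 1 = 0" "Db \<noteq> - 2 \<Longrightarrow> kform Db 3 = 0" "n \<ge> 4 \<Longrightarrow> kform Db n = 0"
  by (simp_all add: fform_def kform_def)


lemma listed_translate:
  "listed al Db Dl f k \<longleftrightarrow>
    (Dl = Db \<and> (\<exists>c0 c1 a0. (c0, c1, a0) \<noteq> (0, 0, 0) \<and>
       translate al f = mono2 c0 0 0 + mono2 c1 0 1 \<and> translate al k = smult [:a0:] (kform Db 0)))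
  \<or> (Dl = Db + 1 \<and> (\<exists>a1. a1 \<noteq> 0 \<and> f = 0 \<and> translate al k = smult [:a1:] (kform Db 1)))
  \<or> (Dl = Db + 2 \<and> (\<exists>c2 a2. (c2, a2) \<noteq> (0, 0) \<and>
       translate al f = smult [:c2:] (fform Db 2) \<and> translate al k = smult [:a2:] (kform Db 2)))
  \<or> (Dl = 1 \<and> Db = - 2 \<and> (\<exists>c3 a3. (c3, a3) \<noteq> (0, 0) \<and>
       translate al f = smult [:c3:] (fform Db 3) \<and> translate al k = smult [:a3:] (kform (- 2) 3)))
  \<or> (Dl = Db + 3 \<and> Db \<noteq> - 2 \<and> (\<exists>c3. c3 \<noteq> 0 \<and> k = 0 \<and> translate al f = smult [:c3:] (fform Db 3)))
  \<or> (Dl = Db + 4 \<and> (\<exists>c5. c5 \<noteq> 0 \<and> k = 0 \<and> translate al f = smult [:c5:] (fform Db 4)))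
  \<or> (Dl = 1 \<and> Db = - 4 \<and> (\<exists>c6. c6 \<noteq> 0 \<and> k = 0 \<and> translate al f = smult [:c6:] (fform (- 4) 5)))
  \<or> ((Dl = Db + 6 \<and> (2 * Db + 5)\<^sup>2 = 19) \<and>
       (\<exists>c7. c7 \<noteq> 0 \<and> k = 0 \<and> translate al f = smult [:c7:] (fform Db 6)))"
proof -
  have eq: "Dl - Db = z \<longleftrightarrow> Dl = Db + z" for z by (auto simp: algebra_simps)
  note E = listed_entries(1,7,9)[where al = al] listed_entries(2-6,8,10)[where al = al and Db = Db]
  show ?thesis
    by (simp only: eq listed_def Let_def sqrt19_iff E cong: conj_cong)
qed

lemma translate_0 [simp]: "translate al 0 = 0"
  by (simp add: translate_eq_0_iff)

lemma translate_form_nonzero: "translate al f = smult [:c:] F \<Longrightarrow> F \<noteq> 0 \<Longrightarrow> c \<noteq> 0 \<Longrightarrow> f \<noteq> 0"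
  by (auto simp: translate_eq_0_iff[symmetric, of f al])

text \<open>The entries run through the degrees in which \<open>fform\<close>, \<open>kform\<close>
  or the constant and linear forms of degree 0 are available. Their nonvanishing conditions on
  coefficients amount to \<open>f\<close> and \<open>k\<close> not both being 0.\<close>

lemma listed_iff:
  "listed al Db Dl f k \<longleftrightarrow>
    (\<exists>n. Dl = Db + of_nat n \<and> f_normal_form Db n (translate al f) \<and> k_normal_form Db n (translate al k) \<and>
      \<not> (f = 0 \<and> k = 0))"
  (is "_ \<longleftrightarrow> ?N")
proof
  have N: ?N if "Dl = Db + of_nat n" "f_normal_form Db n (translate al f)" "k_normal_form Db n (translate al k)" "f \<noteq> 0 \<or> k \<noteq> 0" for n
    using that by blast
  have nfI: "f_normal_form Db n (translate al f)" if "n \<ge> 1" "translate al f = smult [:c:] (fform Db n)" for n c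
    using that unfolding f_normal_form_def by blast
  have kfI: "k_normal_form Db n (translate al k)" if "translate al k = smult [:c:] (kform Db n)" for n c
    using that unfolding k_normal_form_def by blast
  have z: "translate al f = smult [:0:] F" if "f = 0" for f F using that by simp
  assume "listed al Db Dl f k"
  then show ?N
    unfolding listed_translate
  proof (elim disjE exE conjE, goal_cases)
    case (1 c0 c1 a0)
    have "f \<noteq> 0" if "(c0, c1) \<noteq> (0, 0)"
    proof
      assume "f = 0"
      then have 0: "mono2 c0 0 0 + mono2 c1 0 1 = 0" using 1(3) by simp
      show False using arg_cong[OF 0, of "\<lambda>f. cf f 0 0"] arg_cong[OF 0, of "\<lambda>f. cf f 0 1"] that by simp
    qed
    moreover have "k \<noteq> 0" if "a0 \<noteq> 0" using translate_form_nonzero[OF 1(4) kform_nonzero(1) that] .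
    ultimately show ?case using 1 by (intro N[of 0] kfI) (auto simp: f_normal_form_def)
  next
    case (2 a1)
    then show ?case
      using translate_form_nonzero[OF 2(4) kform_nonzero(2)[folded One_nat_def]]
      by (intro N[of 1] nfI[OF _ z] kfI) auto
  next
    case (3 c2 a2)
    then show ?case
      using translate_form_nonzero[OF 3(3) fform_nonzero(1)] translate_form_nonzero[OF 3(4) kform_nonzero(3)]
      by (intro N[of 2] nfI kfI) auto
  next
    case (4 c3 a3)
    then show ?case
      using translate_form_nonzero[OF 4(4) fform_nonzero(2)] translate_form_nonzero[OF 4(5) kform_nonzero(4)]
      by (intro N[of 3] nfI kfI) auto
  next
    case (5 c3)
    then show ?case
      using translate_form_nonzero[OF 5(5) fform_nonzero(2)]
      by (intro N[of 3] nfI kfI[OF z]) auto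
  next
    case (6 c5)
    then show ?case
      using translate_form_nonzero[OF 6(4) fform_nonzero(3)]
      by (intro N[of 4] nfI kfI[OF z]) auto
  next
    case (7 c6)
    then show ?case
      using translate_form_nonzero[OF 7(5) fform_nonzero(4)]
      by (intro N[of 5] nfI kfI[OF z]) auto
  next
    case (8 c7)
    then show ?case
      using translate_form_nonzero[OF 8(5) fform_nonzero(5)]
      by (intro N[of 6] nfI kfI[OF z]) auto
  qed
next
  assume ?N
  then obtain n where n: "Dl = Db + of_nat n" "f_normal_form Db n (translate al f)" "k_normal_form Db n (translate al k)"
    and nz: "\<not> (f = 0 \<and> k = 0)" by blast
  obtain a where a: "translate al k = smult [:a:] (kform Db n)" using n(3) unfolding k_normal_form_def by blast
  show "listed al Db Dl f k"
  proof (cases "n = 0")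
    case True
    then obtain c0 c1 where f: "translate al f = mono2 c0 0 0 + mono2 c1 0 1" using n(2) unfolding f_normal_form_def by auto
    have "(c0, c1, a) \<noteq> (0, 0, 0)"
    proof
      assume "(c0, c1, a) = (0, 0, 0)"
      then have "translate al f = 0" "translate al k = 0" using f a by (simp_all add: mono2_def)
      then show False using nz by (simp add: translate_eq_0_iff)
    qed
    moreover have "Dl = Db" using n(1) True by simp
    ultimately show ?thesis unfolding listed_translate using f a[unfolded True] by - (rule disjI1, blast)
  next
    case False
    then obtain c where c: "translate al f = smult [:c:] (fform Db n)" using n(2) unfolding f_normal_form_def by auto
    have ca: "(c, a) \<noteq> (0, 0)"
    proof
      assume "(c, a) = (0, 0)"
      then have "translate al f = 0" "translate al k = 0" using c a by simp_all
      then show False using nz by (simp add: translate_eq_0_iff)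
    qed
    have f0: "f = 0" if "fform Db n = 0" using c that by (simp add: translate_eq_0_iff)
    have k0: "k = 0" if "kform Db n = 0" using a that by (simp add: translate_eq_0_iff)
    have c0: "c \<noteq> 0" if "k = 0" using that nz c by (auto simp: translate_eq_0_iff)
    have a0: "a \<noteq> 0" if "f = 0" using that nz a by (auto simp: translate_eq_0_iff)
    consider "n = 1" | "n = 2" | "n = 3" "Db = -2" | "n = 3" "Db \<noteq> -2" | "n = 4"
      | "n = 5" "Db = -4" | "n = 6" "(2 * Db + 5)\<^sup>2 = 19" | "fform Db n = 0" "kform Db n = 0"
      using False unfolding fform_def kform_def by argo
    then show ?thesis
    proof cases
      case 1
      then have "Dl = Db + 1" "f = 0" using n(1) f0 form_zero(1) by simp_all
      with a[unfolded 1] a0 show ?thesis unfolding listed_translate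
        by - (rule disjI2, rule disjI1, blast)
    next
      case 2
      then have "Dl = Db + 2" using n(1) by simp
      with a[unfolded 2] c[unfolded 2] ca show ?thesis unfolding listed_translate
        by - (rule disjI2, rule disjI2, rule disjI1, blast)
    next
      case 3
      then have "Dl = 1" using n(1) by simp
      with a[unfolded 3] c[unfolded 3(1)] ca 3(2) show ?thesis unfolding listed_translate
        by - (rule disjI2, rule disjI2, rule disjI2, rule disjI1, blast)
    next
      case 4
      then have "Dl = Db + 3" "k = 0" using n(1) k0 form_zero(2) by simp_all
      with c[unfolded 4] c0 4(2) show ?thesis unfolding listed_translate
        by - (rule disjI2, rule disjI2, rule disjI2, rule disjI2, rule disjI1, blast)
    next
      case 5
      then have "Dl = Db + 4" "k = 0" using n(1) k0 form_zero(3) by simp_all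
      with c[unfolded 5] c0 show ?thesis unfolding listed_translate
        by - (rule disjI2, rule disjI2, rule disjI2, rule disjI2, rule disjI2, rule disjI1, blast)
    next
      case 6
      then have "Dl = 1" "k = 0" using n(1) k0 form_zero(3) by simp_all
      with c[unfolded 6] c0 6(2) show ?thesis unfolding listed_translate
        by - (rule disjI2, rule disjI2, rule disjI2, rule disjI2, rule disjI2, rule disjI2, rule disjI1, blast)
    next
      case 7
      then have "Dl = Db + 6" "k = 0" using n(1) k0 form_zero(3) by simp_all
      with c[unfolded 7(1)] c0 7(2) show ?thesis unfolding listed_translate
        by - (rule disjI2, rule disjI2, rule disjI2, rule disjI2, rule disjI2, rule disjI2, rule disjI2, blast)
    next
      case 8
      then show ?thesis using f0 k0 nz by blast
    qed
  qed
qed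

section \<open>Classification of the nontrivial extensions\<close>

lemma nontrivial_ext_iff:
  assumes "Dl \<noteq> 0" and "Db \<noteq> 0"
  shows "(is_ext al Db Dl f g h k \<and> \<not> ext_trivial al Db Dl f g h k)
            \<longleftrightarrow> (\<exists>f' k'. listed al Db Dl f' k' \<and>
                   ext_equiv al Db Dl (f, g, h, k) (f', 0, 0, k'))"
proof
  assume A: "is_ext al Db Dl f g h k \<and> \<not> ext_trivial al Db Dl f g h k"
  then have gh: "g = 0" "h = 0" and c: "cocycle Db Dl (EV (translate al f))" "current_cocycle Db Dl (EV (translate al k))"
    unfolding is_ext_iff by auto
  from f_classification[OF c(1) assms(2)] obtain \<phi> R where R: "translate al f = cob Db Dl \<phi> + R"
    "R = 0 \<or> (\<exists>n. Dl = Db + of_nat n \<and> f_normal_form Db n R)" by blast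
  have K: "translate al k = 0 \<or> (\<exists>n. Dl = Db + of_nat n \<and> k_normal_form Db n (translate al k))"
    using k_classification[OF c(2) assms(2,1)] unfolding k_normal_form_def by blast
  define f' where "f' = translate (- al) R"
  have f': "translate al f' = R" unfolding f'_def by (rule translate_surj)
  have equiv: "ext_equiv al Db Dl (f, 0, 0, k) (f', 0, 0, k)"
    by (rule ext_equivI[of _ _ _ _ _ "- \<phi>"]) (simp add: f' R(1) cob_minus)
  have nz: "\<not> (f' = 0 \<and> k = 0)"
    using A equiv unfolding ext_trivial_def gh by auto
  then have "\<not> (R = 0 \<and> translate al k = 0)"
    using f' translate_eq_0_iff by blast
  then obtain n where n: "Dl = Db + of_nat n" using R(2) K by blast
  \<comment> \<open>The degree is fixed by \<open>Dl - Db\<close>, so \<open>f'\<close> and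
    \<open>k\<close> have normal forms for the same \<open>n\<close>; a zero component fits every
    degree.\<close>
  then have u: "m = n" if "Dl = Db + of_nat m" for m using that by simp
  have "k_normal_form Db n 0" unfolding k_normal_form_def by (intro exI[of _ 0]) simp
  then have "listed al Db Dl f' k"
    unfolding listed_iff f' using n nz R(2) K f_normal_form_0 u by metis
  then show "\<exists>f' k'. listed al Db Dl f' k' \<and> ext_equiv al Db Dl (f, g, h, k) (f', 0, 0, k')"
    using equiv gh by blast
next
  assume "\<exists>f' k'. listed al Db Dl f' k' \<and> ext_equiv al Db Dl (f, g, h, k) (f', 0, 0, k')"
  then obtain f' k' where l: "listed al Db Dl f' k'"
    and e: "ext_equiv al Db Dl (f, g, h, k) (f', 0, 0, k')" by blast
  from ext_equivD[OF e] obtain \<phi> where gh: "g = 0" "h = 0" "k = k'"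
    and \<phi>: "translate al f' = translate al f + cob Db Dl \<phi>" by blast
  from l obtain n where n: "Dl = Db + of_nat n" "f_normal_form Db n (translate al f')" "k_normal_form Db n (translate al k')"
    and nz: "\<not> (f' = 0 \<and> k' = 0)" unfolding listed_iff by blast
  have f: "translate al f = translate al f' + cob Db Dl (- \<phi>)" using \<phi> by (simp add: cob_minus)
  have "cocycle Db Dl (EV (translate al f))"
    using cocycle_comb[OF cocycle_f_normal_form[OF n(2,1)] cocycle_cob[of Db Dl "- \<phi>"], of 1] by (simp add: f flip: one_pCons)
  moreover have "current_cocycle Db Dl (EV (translate al k))"
  proof -
    from n(3) obtain a where "translate al k = 0 + smult [:a:] (kform Db n)" unfolding k_normal_form_def gh by auto
    then show ?thesis using current_cocycle_comb[of Db Dl 0 "kform Db n" a] current_cocycle_kform[of Db n] n(1)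
      by (simp add: current_cocycle_def)
  qed
  moreover have "\<not> ext_trivial al Db Dl f g h k"
  proof
    \<comment> \<open>Triviality would make the normal form of \<open>f'\<close> a coboundary, hence
      0, and would also give \<open>k = 0\<close>.\<close>
    assume "ext_trivial al Db Dl f g h k"
    from ext_equivD[OF this[unfolded ext_trivial_def]] obtain \<psi> where
      "k = 0" "translate al 0 = translate al f + cob Db Dl \<psi>" by blast
    then have "translate al f' = cob Db Dl (\<phi> + - \<psi>)"
      using \<phi> translate_eq_0_iff[of al 0] unfolding cob_add cob_minus by (simp add: eq_neg_iff_add_eq_0)
    then have "translate al f' = 0" using f_normal_form_cob[of Db n Dl "\<phi> + - \<psi>"] n assms by simp
    then show False using nz \<open>k = 0\<close> gh translate_eq_0_iff by blast
  qed
  ultimately show "is_ext al Db Dl f g h k \<and> \<not> ext_trivial al Db Dl f g h k"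
    unfolding is_ext_iff using gh by blast
qed

theorem theorem5p9:
  fixes al Dl Dbar :: complex
  assumes "Dl \<noteq> 0" and "Dbar \<noteq> 0"
  shows "(\<forall>f g h k. is_ext al Dbar Dl f g h k \<and> \<not> ext_trivial al Dbar Dl f g h k
            \<longrightarrow> Dl - Dbar \<in> {0, 1, 2, 3, 4, 5, 6})
       \<and> (\<forall>f g h k. (is_ext al Dbar Dl f g h k \<and> \<not> ext_trivial al Dbar Dl f g h k)
            \<longleftrightarrow> (\<exists>f' k'. listed al Dbar Dl f' k' \<and>
                   ext_equiv al Dbar Dl (f, g, h, k) (f', 0, 0, k')))"
proof -
  \<comment> \<open>The differences can be read off the list, so the first claim follows from the
    second.\<close>
  have "Dl - Dbar \<in> {0, 1, 2, 3, 4, 5, 6}" if "listed al Dbar Dl f k" for f k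
    using that unfolding listed_def Let_def by (elim disjE conjE bexE) auto
  then show ?thesis using nontrivial_ext_iff[OF assms] by blast
qed

end
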